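(* Assume that for each $i\in\{1,\dots,M\}$ the set $S_i$ is connected and that $\delta=\min_{1\le i<j\le M}\min\{\|x-y\| : (x,y)\in S_i\times S_j\}>0$. Let $\gamma_*=\min_{1\le i\le M}\gamma_i$, $\gamma^*=\max_{1\le i\le M}\gamma_i$, $\bar\gamma=\gamma_*-\gamma^*/2$, and assume that $\gamma^*<2\gamma_*$ and $0\le\varepsilon<\bar\gamma/(1+\bar\gamma)$. Let $\eta_0>0$ and $\eta_1>0$ be such that $$\eta_0=1-[(1-\varepsilon)(1+\bar\gamma)]^{-1}\quad\text{and}\quad \frac{4\eta_1}{1-\eta_1}=\frac{\gamma_*}{\gamma^*}-\frac12 .$$ Then for all $0<\eta\le\min(\eta_0,\eta_1)$ and all $n\ge M$, $$\mathcal R_n(\mathcal X(\widehat r_n))\le \inf_{r>0}\mathcal R_n(\mathcal X(r))+2M\exp\bigl(-\psi(\eta)(1-\varepsilon)\bar\gamma n\bigr),$$ where $\psi(\eta)=(1+\eta)(\log(1+\eta)-1)+1>0$ for $\eta>0$.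
   Context: Model. $D\ge1$, $M\ge 2$ and $n\ge1$ are integers and $\|\cdot\|$ is the Euclidean norm. $X_1,\dots,X_n$ are independent $[0,1]^D$-valued random variables with common law $\mathbb P=\varepsilon\mathbb P_0+(1-\varepsilon)\sum_{i=1}^M\gamma_i\mathbb P_i$, where $0\le\varepsilon<1$, $\gamma_i\ge0$, $\sum_{i=1}^M\gamma_i=1$, and $\mathbb P_0,\dots,\mathbb P_M$ are probability measures on $[0,1]^D$. For $1\le i\le M$, $S_i=\operatorname{supp}(\mathbb P_i)$ (a compact set), and $S_0=[0,1]^D\setminus\bigcup_{i=1}^M S_i$. It is assumed that $\operatorname{supp}(\mathbb P_0)\subseteq\overline{S_0}$ (closure) and $\mathbb P_0(\overline{S_0}\cap S_i)=0$ for $1\le i\le M$. Write $\mathbb X_n=\{X_1,\dots,X_n\}$ (sizes of subsets of the sample are numbers of indices, i.e. counted with multiplicity). The symbol $\mathbb P$ is also used for the probability of events on the sample. Clusters. For $r\ge0$ let $\mathcal Y_1(r),\dots,\mathcal Y_{M(r)}(r)$ be the intersections of $\mathbb X_n$ with the connected components of $\bigcup_{k=1}^n B(X_k,r/2)$, where $B(x,\rho)$ is the closed Euclidean ball; equivalently, the connected components of the graph on the observations joining $X_k$ and $X_l$ when $\|X_k-X_l\|\le r$. They are indexed by decreasing size, ties being broken by declaring larger the cluster containing the smallest observation index. Set $\mathcal X_m(r)=\mathcal Y_m(r)$ for $1\le m\le \min(M,M(r))$, $\mathcal X_m(r)=\emptyset$ for $M(r)<m\le M$, and $\mathcal X(r)=\{\mathcal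 X_1(r),\dots,\mathcal X_M(r)\}$. Selected radius. Let $0=\rho_0<\rho_1<\dots<\rho_K$ be the successive radii at which the partition $\{\mathcal Y_m(r)\}_m$ changes as $r$ increases from $0$ ($\rho_K$ being the radius from which all observations form a single cluster). Then $\widehat r_n=\max\operatorname{argmax}_{\rho\in\{\rho_0,\dots,\rho_{K-1}\}}|\mathcal X_M(\rho)|$ (with $\widehat r_n=0$ if $K=0$). Clustering risk. For a (possibly random) radius $r$, with $\Pi_M$ the set of permutations of $\{1,\dots,M\}$, $$\mathcal R_n(\mathcal X(r))=\mathbb P\bigl(\forall\pi\in\Pi_M,\ \exists i\in\{1,\dots,M\},\ \mathbb X_n\cap S_i\nsubseteq\mathcal X_{\pi(i)}(r)\bigr).$$ *)

theory Defs
  imports "HOL-Probability.Probability" "HOL-Combinatorics.Permutations"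
begin

definition measure_support :: "'a::topological_space measure \<Rightarrow> 'a set" where
  "measure_support \<mu> = {x. \<forall>U. open U \<longrightarrow> x \<in> U \<longrightarrow> emeasure \<mu> U > 0}"

text \<open>
  In the following, a sample of size n is a function x whose values at 1, ..., n are the
  observations. Subsets of the sample are sets of points; since observations may coincide,
  their size is the number of observation indices falling in them.
\<close>

definition sample_points :: "nat \<Rightarrow> (nat \<Rightarrow> 'a) \<Rightarrow> 'a set" where
  "sample_points n x = x ` {1..n}"

definition sample_size :: "nat \<Rightarrow> (nat \<Rightarrow> 'a) \<Rightarrow> 'a set \<Rightarrow> nat" where
  "sample_size n x A = card {k \<in> {1..n}. x k \<in> A}"

definition first_index :: "nat \<Rightarrow> (nat \<Rightarrow> 'a) \<Rightarrow> 'a set \<Rightarrow> nat" where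
  "first_index n x A = Min {k \<in> {1..n}. x k \<in> A}"

definition clusters :: "nat \<Rightarrow> (nat \<Rightarrow> 'a::metric_space) \<Rightarrow> real \<Rightarrow> 'a set set" where
  "clusters n x r =
     (\<lambda>C. sample_points n x \<inter> C) ` components (\<Union>k\<in>{1..n}. cball (x k) (r / 2))"

definition precedes :: "nat \<Rightarrow> (nat \<Rightarrow> 'a) \<Rightarrow> 'a set \<Rightarrow> 'a set \<Rightarrow> bool" where
  "precedes n x A B \<longleftrightarrow>
     sample_size n x A > sample_size n x B \<or>
     sample_size n x A = sample_size n x B \<and> first_index n x A < first_index n x B"

text \<open>
  Disjoint nonempty clusters have distinct first indices, so \<open>precedes\<close> is a strict total order
  on the finite set of clusters. The m-th cluster (counting from 1) is the one preceded by exactly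
  m - 1 others; it exists and is unique for m between 1 and the number of clusters.
\<close>

definition nth_cluster :: "nat \<Rightarrow> (nat \<Rightarrow> 'a::metric_space) \<Rightarrow> real \<Rightarrow> nat \<Rightarrow> 'a set" where
  "nth_cluster n x r m =
     (THE C. C \<in> clusters n x r \<and> Suc (card {B \<in> clusters n x r. precedes n x B C}) = m)"

definition main_cluster :: "nat \<Rightarrow> (nat \<Rightarrow> 'a::metric_space) \<Rightarrow> real \<Rightarrow> nat \<Rightarrow> 'a set" where
  "main_cluster n x r m = (if m \<le> card (clusters n x r) then nth_cluster n x r m else {})"

text \<open>
  As r increases the clusters can only merge, and the partition is right-continuous in r (closed
  balls). Hence the partition changes at r exactly when it differs from the partition at every
  smaller radius.
\<close>

definition change_radii :: "nat \<Rightarrow> (nat \<Rightarrow> 'a::metric_space) \<Rightarrow> real set" where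
  "change_radii n x = {r. 0 < r \<and> (\<forall>s. 0 \<le> s \<and> s < r \<longrightarrow> clusters n x s \<noteq> clusters n x r)}"

text \<open>The radii \<open>\<rho>\<^sub>0 = 0, \<rho>\<^sub>1, \<dots>\<close> without the last one, \<open>\<rho>\<^sub>K\<close>; the set is empty iff \<open>K = 0\<close>.\<close>

definition candidate_radii :: "nat \<Rightarrow> (nat \<Rightarrow> 'a::metric_space) \<Rightarrow> real set" where
  "candidate_radii n x = insert 0 (change_radii n x) - {Max (insert 0 (change_radii n x))}"

definition selected_radius :: "nat \<Rightarrow> nat \<Rightarrow> (nat \<Rightarrow> 'a::metric_space) \<Rightarrow> real" where
  "selected_radius M n x =
     (if candidate_radii n x = {} then 0
      else Max {\<rho>. is_arg_max (\<lambda>\<rho>. sample_size n x (main_cluster n x \<rho> M))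
                              (\<lambda>\<rho>. \<rho> \<in> candidate_radii n x) \<rho>})"

text \<open>The radius R may depend on the outcome \<open>\<omega>\<close>; a deterministic radius is a constant function.\<close>

definition clustering_risk ::
  "'w measure \<Rightarrow> nat \<Rightarrow> nat \<Rightarrow> (nat \<Rightarrow> 'a::metric_space set) \<Rightarrow>
   (nat \<Rightarrow> 'w \<Rightarrow> 'a) \<Rightarrow> ('w \<Rightarrow> real) \<Rightarrow> real" where
  "clustering_risk \<Omega> M n S X R =
     measure \<Omega> {\<omega> \<in> space \<Omega>. \<forall>\<pi>. \<pi> permutes {1..M} \<longrightarrow>
       (\<exists>i\<in>{1..M}. \<not> sample_points n (\<lambda>k. X k \<omega>) \<inter> S i
                        \<subseteq> main_cluster n (\<lambda>k. X k \<omega>) (R \<omega>) (\<pi> i))}"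

definition psi :: "real \<Rightarrow> real" where
  "psi \<eta> = (1 + \<eta>) * (ln (1 + \<eta>) - 1) + 1"

end

theory Submission
  imports Defs
begin

text \<open>
  The group counts \<open>N\<^sub>i\<close> are binomial, and by Chernoff's bound all of them are within a factor
  \<open>1 \<plusminus> \<eta>\<close> of their means except with the stated probability. On the remaining event, the
  noise is smaller than the common lower bound \<open>b\<close> on the group counts, and two disjoint sets of
  size at least \<open>b\<close> do not fit into one group together with the noise. If some radius \<open>r\<close> succeeds, then so
  does the selected one: at a larger radius every main cluster still exceeds the noise, so it
  contains a whole group; at a smaller radius the \<open>M\<close> main clusters lie in distinct clusters at \<open>r\<close>,
  so the \<open>M\<close>-th one cannot be larger than at \<open>r\<close>, and the tie rule prefers the larger radius.
\<close>

subsection \<open>Ranked blocks of a partition\<close>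

text \<open>Observations may coincide, while sizes and tie-breaking count indices. Clusters are
  therefore replaced by blocks of \<open>{1..n}\<close>: for \<open>r \<ge> 0\<close> coinciding
  observations share a block, so a block is recovered from its set of points, and comparing two
  radii becomes comparing two partitions, one refining the other. The two thresholds fit the two
  size conditions. With \<open>m = (1 - \<epsilon>) n\<close> and
  \<open>b = \<gamma>_min (1 - \<eta>) m\<close>, the bound by \<open>\<eta>0\<close> keeps the
  noise at most \<open>\<gamma>_bar (1 - \<eta>) m\<close>, hence below \<open>b\<close>, and the
  bound by \<open>\<eta>1\<close> keeps the largest group plus this noise below \<open>2 b\<close>.
  The concentration event concerns counts alone and is the same for every radius. Success thus
  passes from a fixed \<open>r\<close> to the selected radius outcome by outcome; the random radius
  enters the probabilities only through an inclusion of events.\<close>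

definition ranked_before :: "nat set \<Rightarrow> nat set \<Rightarrow> bool" where
  "ranked_before A B \<longleftrightarrow> card A > card B \<or> card A = card B \<and> Min A < Min B"

text \<open>For a set of indices, \<open>card\<close> is the size with multiplicity and
  \<open>Min\<close> the first index, so this is the index version of the rank by
  \<open>precedes\<close> in \<open>nth_cluster\<close>.\<close>

definition block_rank :: "nat set set \<Rightarrow> nat set \<Rightarrow> nat" where
  "block_rank Q A = Suc (card {B \<in> Q. ranked_before B A})"

text \<open>Ranks are injective on a finite partition, so the union has at most one member. Unlike a
  definite description it is \<open>{}\<close> when no block has rank \<open>m\<close>, the default
  value of \<open>main_cluster\<close> too.\<close>

definition nth_block :: "nat set set \<Rightarrow> nat \<Rightarrow> nat set" where
  "nth_block Q m = \<Union>{A \<in> Q. block_rank Q A = m}"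

text \<open>The complement of the event in \<open>clustering_risk\<close>, stated for indices:
  \<open>N i\<close> stands for the observations in \<open>S i\<close>, and \<open>Q\<close> for the
  partition into clusters.\<close>

definition captures :: "nat \<Rightarrow> (nat \<Rightarrow> nat set) \<Rightarrow> nat set set \<Rightarrow> bool" where
  "captures M N Q \<longleftrightarrow> (\<exists>\<pi>. \<pi> permutes {1..M} \<and> (\<forall>i\<in>{1..M}. N i \<subseteq> nth_block Q (\<pi> i)))"

lemma ranked_before_trans: "ranked_before A B \<Longrightarrow> ranked_before B C \<Longrightarrow> ranked_before A C"
  by (auto simp: ranked_before_def)

lemma ranked_before_irrefl: "\<not> ranked_before A A"
  by (auto simp: ranked_before_def)

locale finite_partition =
  fixes V :: "nat set" and Q :: "nat set set"
  assumes fin: "finite V" and part: "partition_on V Q"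
begin

lemma finite_Q: "finite Q"
  using finite_elements[OF fin part] .

lemma finite_block: "A \<in> Q \<Longrightarrow> finite A"
  using fin part finite_subset[of A V] by (auto simp: partition_on_def)

lemma block_nonempty: "A \<in> Q \<Longrightarrow> A \<noteq> {}"
  using part by (auto simp: partition_on_def)

lemma block_subset: "A \<in> Q \<Longrightarrow> A \<subseteq> V"
  using part by (auto simp: partition_on_def)

lemma block_eqI: "A \<in> Q \<Longrightarrow> B \<in> Q \<Longrightarrow> k \<in> A \<Longrightarrow> k \<in> B \<Longrightarrow> A = B"
  using part by (auto simp: partition_on_def disjoint_def)

lemma ranked_before_total:
  assumes "A \<in> Q" "B \<in> Q" "A \<noteq> B"
  shows "ranked_before A B \<or> ranked_before B A"
proof -
  have "Min A \<in> A" "Min B \<in> B"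
    using assms finite_block block_nonempty by (auto intro!: Min_in)
  then have "Min A \<noteq> Min B"
    using block_eqI assms by metis
  then show ?thesis
    by (auto simp: ranked_before_def)
qed

lemma block_rank_less:
  assumes "A \<in> Q" "B \<in> Q" "ranked_before A B"
  shows "block_rank Q A < block_rank Q B"
proof -
  have "{C \<in> Q. ranked_before C A} \<subset> {C \<in> Q. ranked_before C B}"
    using assms ranked_before_trans ranked_before_irrefl by blast
  then have "card {C \<in> Q. ranked_before C A} < card {C \<in> Q. ranked_before C B}"
    using finite_Q by (intro psubset_card_mono) auto
  then show ?thesis
    by (simp add: block_rank_def)
qed

text \<open>The rank is strictly monotone along a total order, hence injective; its values lie in
  \<open>{1..card Q}\<close>, so counting gives surjectivity.\<close>

lemma bij_betw_block_rank: "bij_betw (block_rank Q) Q {1..card Q}"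
proof -
  have inj: "inj_on (block_rank Q) Q"
    by (rule inj_onI) (metis block_rank_less ranked_before_total less_irrefl)
  have "block_rank Q A \<in> {1..card Q}" if "A \<in> Q" for A
  proof -
    have "{B \<in> Q. ranked_before B A} \<subset> Q"
      using that ranked_before_irrefl by blast
    then have "card {B \<in> Q. ranked_before B A} < card Q"
      using finite_Q by (intro psubset_card_mono) auto
    then show ?thesis
      by (auto simp: block_rank_def)
  qed
  then have "block_rank Q ` Q \<subseteq> {1..card Q}"
    by auto
  moreover have "card (block_rank Q ` Q) = card {1..card Q}"
    using card_image[OF inj] by simp
  ultimately have "block_rank Q ` Q = {1..card Q}"
    by (intro card_subset_eq) auto
  with inj show ?thesis
    by (auto simp: bij_betw_def)
qed

lemma nth_block_rank:
  assumes "A \<in> Q"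
  shows "nth_block Q (block_rank Q A) = A"
proof -
  have "{B \<in> Q. block_rank Q B = block_rank Q A} = {A}"
    using bij_betw_block_rank assms by (auto simp: bij_betw_def inj_on_def)
  then show ?thesis
    by (simp add: nth_block_def)
qed

lemma nth_block_in:
  assumes "m \<in> {1..card Q}"
  shows "nth_block Q m \<in> Q" "block_rank Q (nth_block Q m) = m"
proof -
  obtain A where "A \<in> Q" "block_rank Q A = m"
    using bij_betw_block_rank assms unfolding bij_betw_def by (metis imageE)
  then show "nth_block Q m \<in> Q" "block_rank Q (nth_block Q m) = m"
    using nth_block_rank by auto
qed

lemma nth_block_empty:
  assumes "m \<notin> {1..card Q}"
  shows "nth_block Q m = {}"
  using bij_betw_block_rank assms by (force simp: nth_block_def bij_betw_def)

lemma nth_block_nonempty_in: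
  assumes "k \<in> nth_block Q m"
  shows "nth_block Q m \<in> Q" "m \<in> {1..card Q}"
  using assms nth_block_in nth_block_empty by blast+

lemma nth_block_index_unique:
  assumes "k \<in> nth_block Q m" "k \<in> nth_block Q m'"
  shows "m = m'"
  using assms nth_block_in(2) nth_block_nonempty_in block_eqI by metis

text \<open>Carries lower bounds on the \<open>M\<close>-th block over to all main blocks. Ranks
  beyond \<open>card Q\<close> are covered by the empty default.\<close>

lemma card_nth_block_antimono:
  assumes "1 \<le> m" "m \<le> m'"
  shows "card (nth_block Q m') \<le> card (nth_block Q m)"
proof (cases "m' \<in> {1..card Q} \<and> m \<noteq> m'")
  case True
  with assms have m: "m \<in> {1..card Q}" and m': "m' \<in> {1..card Q}" and "m < m'"
    by auto
  then have "\<not> ranked_before (nth_block Q m') (nth_block Q m)"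
    using block_rank_less[OF nth_block_in(1)[OF m'] nth_block_in(1)[OF m]]
      nth_block_in(2)[OF m] nth_block_in(2)[OF m'] by auto
  then show ?thesis
    by (auto simp: ranked_before_def)
qed (use nth_block_empty in auto)

end

section \<open>Capturing in coarser and finer partitions\<close>

lemma finite_partition_refines:
  assumes "finite V" "refines V Q Q'"
  shows "finite_partition V Q" "finite_partition V Q'"
  using assms by (auto simp: refines_def finite_partition_def)

text \<open>Finiteness turns an injective choice of groups into a bijection, which is continued by
  the identity outside \<open>A\<close>.\<close>

lemma inj_on_extends_to_permutation:
  assumes "finite A" "s ` A \<subseteq> A" "inj_on s A"
  obtains \<sigma> where "\<sigma> permutes A" "\<And>a. a \<in> A \<Longrightarrow> \<sigma> a = s a"
proof
  have "bij_betw s A A"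
    using assms by (simp add: bij_betw_def endo_inj_surj)
  then show "restrict_id s A permutes A"
    by (rule permutes_restrict_id)
qed simp

text \<open>A block disjoint from all groups would consist of noise, but by monotonicity of sizes
  each main block is larger than the whole noise.\<close>

lemma (in finite_partition) nth_block_meets:
  assumes "card (V - (\<Union>i\<in>{1..M}. N i)) < card (nth_block Q M)" "m \<in> {1..M}"
  shows "\<exists>i\<in>{1..M}. N i \<inter> nth_block Q m \<noteq> {}"
proof (rule ccontr)
  assume *: "\<not> ?thesis"
  have lt: "card (V - (\<Union>i\<in>{1..M}. N i)) < card (nth_block Q m)"
    using assms card_nth_block_antimono[of m M] by auto
  \<comment> \<open>The strict inequality rules out the empty default, so this is a genuine
    block.\<close>
  then have "nth_block Q m \<subseteq> V"
    using block_subset nth_block_nonempty_in by (metis all_not_in_conv card.empty not_less_zero)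
  then have "nth_block Q m \<subseteq> V - (\<Union>i\<in>{1..M}. N i)"
    using * by auto
  then show False
    using lt fin card_mono[of "V - (\<Union>i\<in>{1..M}. N i)" "nth_block Q m"] by auto
qed

text \<open>Coarsening keeps each group inside one block \<open>J i\<close>. Every main block of
  \<open>Q'\<close> meets some group \<open>s m\<close> and so equals \<open>J (s m)\<close>.
  Distinct main blocks thus choose distinct groups, and as there are \<open>M\<close> of both,
  \<open>s\<close> is a permutation whose inverse assigns the groups.\<close>

lemma captures_coarser:
  assumes fin: "finite V" and ref: "refines V Q Q'" and cap: "captures M N Q"
    and N: "\<And>i. i \<in> {1..M} \<Longrightarrow> N i \<noteq> {}"
    and big: "card (V - (\<Union>i\<in>{1..M}. N i)) < card (nth_block Q' M)"
  shows "captures M N Q'"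
proof -
  interpret Q: finite_partition V Q
    using finite_partition_refines(1)[OF fin ref] .
  interpret Q': finite_partition V Q'
    using finite_partition_refines(2)[OF fin ref] .
  obtain \<pi> where \<pi>: "\<And>i. i \<in> {1..M} \<Longrightarrow> N i \<subseteq> nth_block Q (\<pi> i)"
    using cap unfolding captures_def by blast
  have "\<exists>J\<in>Q'. N i \<subseteq> J" if "i \<in> {1..M}" for i
    using \<pi>[OF that] N[OF that] Q.nth_block_nonempty_in(1) ref unfolding refines_def
    by (meson ex_in_conv subsetD subset_trans)
  then obtain J where J: "\<And>i. i \<in> {1..M} \<Longrightarrow> J i \<in> Q'" "\<And>i. i \<in> {1..M} \<Longrightarrow> N i \<subseteq> J i"
    by metis
  obtain s where s: "\<And>m. m \<in> {1..M} \<Longrightarrow> s m \<in> {1..M}"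
      "\<And>m. m \<in> {1..M} \<Longrightarrow> N (s m) \<inter> nth_block Q' m \<noteq> {}"
    using Q'.nth_block_meets[OF big] by metis
  have J_s: "J (s m) = nth_block Q' m" if m: "m \<in> {1..M}" for m
  proof -
    obtain k where "k \<in> N (s m)" "k \<in> nth_block Q' m"
      using s(2)[OF m] by auto
    then show ?thesis
      using J s(1)[OF m] Q'.nth_block_nonempty_in(1) Q'.block_eqI by blast
  qed
  have "inj_on s {1..M}"
  proof (rule inj_onI)
    fix m m' assume "m \<in> {1..M}" "m' \<in> {1..M}" "s m = s m'"
    then show "m = m'"
      using J_s s(2) Q'.nth_block_index_unique by (metis Int_iff ex_in_conv)
  qed
  moreover have "s ` {1..M} \<subseteq> {1..M}"
    using s(1) by blast
  ultimately obtain \<sigma> where \<sigma>: "\<sigma> permutes {1..M}" "\<And>m. m \<in> {1..M} \<Longrightarrow> \<sigma> m = s m"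
    using inj_on_extends_to_permutation[OF finite_atLeastAtMost] by blast
  have "N i \<subseteq> nth_block Q' (inv \<sigma> i)" if "i \<in> {1..M}" for i
  proof -
    have "inv \<sigma> i \<in> {1..M}" "\<sigma> (inv \<sigma> i) = i"
      using that \<sigma>(1) permutes_inv permutes_in_image permutes_inverses(1) by metis+
    then show ?thesis
      using J(2)[OF that] J_s \<sigma>(2) by metis
  qed
  then show ?thesis
    unfolding captures_def using permutes_inv[OF \<sigma>(1)] by blast
qed

text \<open>Here \<open>Q'\<close> is the finer partition. Each of its main blocks meets a group
  \<open>s m\<close> and lies in the block of \<open>Q\<close> capturing that group, which holds
  only that group and noise. Two main blocks do not fit there, so \<open>s\<close> is a permutation
  and some main block of \<open>Q'\<close> lies in the \<open>M\<close>-th block of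
  \<open>Q\<close>.\<close>

lemma captures_finer_card_le:
  assumes fin: "finite V" and ref: "refines V Q' Q" and cap: "captures M N Q"
    and N: "\<And>i. i \<in> {1..M} \<Longrightarrow> N i \<subseteq> V" and M: "1 \<le> M"
    and big: "card (V - (\<Union>i\<in>{1..M}. N i)) < card (nth_block Q' M)"
    and small: "\<And>i. i \<in> {1..M} \<Longrightarrow>
      card (N i) + card (V - (\<Union>i\<in>{1..M}. N i)) < 2 * card (nth_block Q' M)"
  shows "card (nth_block Q' M) \<le> card (nth_block Q M)"
proof -
  interpret Q': finite_partition V Q'
    using finite_partition_refines(1)[OF fin ref] .
  interpret Q: finite_partition V Q
    using finite_partition_refines(2)[OF fin ref] .
  let ?N0 = "V - (\<Union>i\<in>{1..M}. N i)"
  obtain \<pi> where perm: "\<pi> permutes {1..M}"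
    and \<pi>: "\<And>i. i \<in> {1..M} \<Longrightarrow> N i \<subseteq> nth_block Q (\<pi> i)"
    using cap unfolding captures_def by blast
  obtain s where s: "\<And>m. m \<in> {1..M} \<Longrightarrow> s m \<in> {1..M}"
      "\<And>m. m \<in> {1..M} \<Longrightarrow> N (s m) \<inter> nth_block Q' m \<noteq> {}"
    using Q'.nth_block_meets[OF big] by metis
  \<comment> \<open>Distinct groups are captured by distinct ranks, so a point of another group
    would lie in two different blocks of \<open>Q\<close>.\<close>
  have in_Q: "nth_block Q (\<pi> i) \<inter> V \<subseteq> N i \<union> ?N0" if "i \<in> {1..M}" for i
  proof
    fix k assume k: "k \<in> nth_block Q (\<pi> i) \<inter> V"
    have "j = i" if "j \<in> {1..M}" "k \<in> N j" for j
      using that k \<pi>[OF that(1)] Q.nth_block_index_unique[of k "\<pi> j" "\<pi> i"] perm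
      by (auto dest: permutes_inj injD)
    then show "k \<in> N i \<union> ?N0"
      using k by auto
  qed
  have sub: "nth_block Q' m \<subseteq> nth_block Q (\<pi> (s m))" "nth_block Q' m \<subseteq> V" if m: "m \<in> {1..M}" for m
  proof -
    obtain k where k: "k \<in> N (s m)" "k \<in> nth_block Q' m"
      using s(2)[OF m] by auto
    have "nth_block Q' m \<in> Q'"
      using k Q'.nth_block_nonempty_in by blast
    then obtain J where J: "J \<in> Q" "nth_block Q' m \<subseteq> J"
      using ref by (auto simp: refines_def)
    have "k \<in> nth_block Q (\<pi> (s m))"
      using k \<pi> s(1)[OF m] by auto
    then have "J = nth_block Q (\<pi> (s m))"
      using J k Q.block_eqI Q.nth_block_nonempty_in by blast
    then show "nth_block Q' m \<subseteq> nth_block Q (\<pi> (s m))" "nth_block Q' m \<subseteq> V"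
      using J Q.block_subset by auto
  qed
  have "inj_on s {1..M}"
  proof (rule inj_onI, rule ccontr)
    fix m m' assume m: "m \<in> {1..M}" "m' \<in> {1..M}" "s m = s m'" "m \<noteq> m'"
    have "nth_block Q' m \<union> nth_block Q' m' \<subseteq> N (s m) \<union> ?N0"
      using sub[OF m(1)] sub[OF m(2)] in_Q[OF s(1)[OF m(1)]] m(3) by auto
    moreover have "finite (N (s m) \<union> ?N0)"
      using fin N[OF s(1)[OF m(1)]] finite_subset by auto
    ultimately have "card (nth_block Q' m \<union> nth_block Q' m') \<le> card (N (s m) \<union> ?N0)"
      by (intro card_mono)
    also have "\<dots> \<le> card (N (s m)) + card ?N0"
      by (rule card_Un_le)
    also have "\<dots> < 2 * card (nth_block Q' M)"
      using small[OF s(1)[OF m(1)]] .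
    finally have "card (nth_block Q' m \<union> nth_block Q' m') < 2 * card (nth_block Q' M)" .
    moreover have "card (nth_block Q' m \<union> nth_block Q' m') = card (nth_block Q' m) + card (nth_block Q' m')"
      using m sub[OF m(1)] sub[OF m(2)] fin Q'.nth_block_index_unique
      by (intro card_Un_disjoint) (auto intro: finite_subset)
    ultimately show False
      using Q'.card_nth_block_antimono[of m M] Q'.card_nth_block_antimono[of m' M] m by auto
  qed
  moreover have "s ` {1..M} \<subseteq> {1..M}"
    using s(1) by blast
  ultimately obtain \<sigma> where \<sigma>: "\<sigma> permutes {1..M}" "\<And>m. m \<in> {1..M} \<Longrightarrow> \<sigma> m = s m"
    using inj_on_extends_to_permutation[OF finite_atLeastAtMost] by blast
  \<comment> \<open>The block of rank \<open>m\<close> need not be the \<open>M\<close>-th one of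
    \<open>Q'\<close>, but it is at least as large, which is the direction needed.\<close>
  obtain m where m: "(\<pi> \<circ> \<sigma>) m = M" "m \<in> {1..M}"
    using permutes_compose[OF \<sigma>(1) perm] M
    by (metis atLeastAtMost_iff order_refl permutes_image imageE)
  have "card (nth_block Q' M) \<le> card (nth_block Q' m)"
    using m Q'.card_nth_block_antimono by auto
  also have "\<dots> \<le> card (nth_block Q M)"
  proof (rule card_mono)
    show "nth_block Q' m \<subseteq> nth_block Q M"
      using sub(1)[OF m(2)] m \<sigma>(2) by auto
    show "finite (nth_block Q M)"
      using Q.finite_block Q.nth_block_nonempty_in by (metis all_not_in_conv finite.emptyI)
  qed
  finally show ?thesis .
qed

text \<open>The group that the permutation sends to rank \<open>M\<close> lies in the
  \<open>M\<close>-th block.\<close>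

lemma (in finite_partition) captures_imp_card_nth_block_ge:
  assumes "captures M N Q" "1 \<le> M"
  shows "\<exists>i\<in>{1..M}. card (N i) \<le> card (nth_block Q M)"
proof -
  obtain \<pi> where perm: "\<pi> permutes {1..M}"
    and \<pi>: "\<And>i. i \<in> {1..M} \<Longrightarrow> N i \<subseteq> nth_block Q (\<pi> i)"
    using assms by (auto simp: captures_def)
  obtain i where i: "\<pi> i = M" "i \<in> {1..M}"
    using perm assms by (metis atLeastAtMost_iff order_refl permutes_image imageE)
  have "finite (nth_block Q M)"
    using finite_block nth_block_nonempty_in by (metis all_not_in_conv finite.emptyI)
  then show ?thesis
    using \<pi>[OF i(2)] i card_mono by blast
qed

subsection \<open>Clusters as blocks of indices\<close>

definition proximity :: "nat \<Rightarrow> (nat \<Rightarrow> 'a::metric_space) \<Rightarrow> real \<Rightarrow> (nat \<times> nat) set" where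
  "proximity n x r = {(k, l). k \<in> {1..n} \<and> l \<in> {1..n} \<and> dist (x k) (x l) \<le> r}"

text \<open>For \<open>r \<ge> 0\<close> the relation \<open>proximity\<close> is already reflexive
  on \<open>{1..n}\<close>, so \<open>trancl\<close> gives an equivalence on exactly this set,
  whereas \<open>rtrancl\<close> would add pairs outside it.\<close>

definition index_blocks :: "nat \<Rightarrow> (nat \<Rightarrow> 'a::metric_space) \<Rightarrow> real \<Rightarrow> nat set set" where
  "index_blocks n x r = {1..n} // (proximity n x r)\<^sup>+"

lemma proximity_mono: "r \<le> s \<Longrightarrow> proximity n x r \<subseteq> proximity n x s"
  by (auto simp: proximity_def)

lemma equiv_trancl_proximity:
  assumes "0 \<le> r"
  shows "equiv {1..n} ((proximity n x r)\<^sup>+)"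
proof (rule equivI)
  show "(proximity n x r)\<^sup>+ \<subseteq> {1..n} \<times> {1..n}"
    by (rule trancl_subset_Sigma) (auto simp: proximity_def)
  show "refl_on {1..n} ((proximity n x r)\<^sup>+)"
    using assms by (auto simp: refl_on_def proximity_def)
  show "sym ((proximity n x r)\<^sup>+)"
    by (rule sym_trancl) (auto simp: sym_def proximity_def dist_commute)
qed auto

lemma finite_partition_index_blocks:
  "0 \<le> r \<Longrightarrow> finite_partition {1..n} (index_blocks n x r)"
  unfolding index_blocks_def finite_partition_def
  by (intro conjI finite_atLeastAtMost partition_on_quotient equiv_trancl_proximity)

lemma index_blocks_refines:
  assumes "0 \<le> r" "r \<le> s"
  shows "refines {1..n} (index_blocks n x r) (index_blocks n x s)"
  unfolding refines_def
proof (intro conjI ballI)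
  show "partition_on {1..n} (index_blocks n x r)" "partition_on {1..n} (index_blocks n x s)"
    using assms finite_partition_index_blocks finite_partition.part by (metis order_trans)+
  fix I assume "I \<in> index_blocks n x r"
  then obtain k where k: "k \<in> {1..n}" "I = (proximity n x r)\<^sup>+ `` {k}"
    by (auto simp: index_blocks_def quotient_def)
  have "I \<subseteq> (proximity n x s)\<^sup>+ `` {k}"
    using k trancl_mono[OF _ proximity_mono[OF assms(2)]] by blast
  moreover have "(proximity n x s)\<^sup>+ `` {k} \<in> index_blocks n x s"
    using k by (auto simp: index_blocks_def quotient_def)
  ultimately show "\<exists>J\<in>index_blocks n x s. I \<subseteq> J"
    by blast
qed

text \<open>The midpoint of the centres lies in both balls; this is where the linear structure of
  the space enters.\<close>

lemma connected_two_cballs: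
  fixes a b :: "'a::real_normed_vector"
  assumes "dist a b \<le> r"
  shows "connected (cball a (r / 2) \<union> cball b (r / 2))"
proof (rule connected_Un)
  have "midpoint a b \<in> cball a (r / 2) \<inter> cball b (r / 2)"
    using assms by (simp add: dist_midpoint)
  then show "cball a (r / 2) \<inter> cball b (r / 2) \<noteq> {}"
    by blast
qed (auto intro: convex_connected)

text \<open>From right to left, consecutive balls along a path overlap. Conversely, the balls around
  indices reachable from \<open>k\<close> and the remaining balls form two disjoint closed sets, so
  a connected set through \<open>x k\<close> stays in the first.\<close>

lemma connected_component_cballs_iff:
  fixes x :: "nat \<Rightarrow> 'a::real_normed_vector"
  assumes r: "0 \<le> r" and k: "k \<in> {1..n}" and l: "l \<in> {1..n}"
  shows "connected_component (\<Union>k\<in>{1..n}. cball (x k) (r / 2)) (x k) (x l) \<longleftrightarrow>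
    (k, l) \<in> (proximity n x r)\<^sup>+" (is "connected_component ?U _ _ \<longleftrightarrow> _")
proof
  assume "connected_component ?U (x k) (x l)"
  then obtain T where T: "connected T" "T \<subseteq> ?U" "x k \<in> T" "x l \<in> T"
    by (auto simp: connected_component_def)
  let ?K = "(proximity n x r)\<^sup>+ `` {k}"
  let ?A = "\<Union>j\<in>?K \<inter> {1..n}. cball (x j) (r / 2)"
  let ?B = "\<Union>j\<in>{1..n} - ?K. cball (x j) (r / 2)"
  have k_K: "k \<in> ?K"
    using k r by (auto simp: proximity_def)
  \<comment> \<open>A point common to two balls puts their centres within \<open>r\<close>, so
    reachability passes from one index to the other.\<close>
  have disj: "?A \<inter> ?B = {}"
  proof -
    have "i \<in> ?K" if "j \<in> ?K" "j \<in> {1..n}" "i \<in> {1..n}" "z \<in> cball (x j) (r / 2)" "z \<in> cball (x i) (r / 2)" for i j z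
    proof -
      have "dist (x j) (x i) \<le> r"
        using that(4,5) dist_triangle2[of "x j" "x i" z] by simp
      then have "(j, i) \<in> proximity n x r"
        using that by (auto simp: proximity_def)
      then show ?thesis
        using that(1) by (auto intro: trancl_into_trancl)
    qed
    then show ?thesis
      by blast
  qed
  have "closed ?A" "closed ?B"
    by (auto intro!: closed_UN)
  moreover have "T \<subseteq> ?A \<union> ?B"
    using T(2) by blast
  moreover have "x k \<in> ?A \<inter> T"
    using T(3) k k_K r by (intro IntI UN_I[of k]) auto
  ultimately have "?B \<inter> T = {}"
    using connected_closedD[OF T(1), of ?A ?B] disj by (metis disjoint_iff inf_bot_left IntE IntI)
  then have "x l \<notin> ?B"
    using T(4) by blast
  then have "l \<in> ?K"
    using l r by (metis DiffI UN_I centre_in_cball divide_nonneg_pos zero_less_numeral)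
  then show "(k, l) \<in> (proximity n x r)\<^sup>+"
    by simp
next
  have edge: "connected_component ?U (x i) (x j)" if ij: "(i, j) \<in> proximity n x r" for i j
  proof (rule connected_componentI)
    show "connected (cball (x i) (r / 2) \<union> cball (x j) (r / 2))"
      using ij by (intro connected_two_cballs) (simp add: proximity_def)
    have "i \<in> {1..n}" "j \<in> {1..n}"
      using ij by (auto simp: proximity_def)
    then show "cball (x i) (r / 2) \<union> cball (x j) (r / 2) \<subseteq> ?U"
      by blast
  qed (use r in auto)
  assume "(k, l) \<in> (proximity n x r)\<^sup>+"
  then show "connected_component ?U (x k) (x l)"
  proof induction
    case (base j)
    then show ?case by (rule edge)
  next
    case (step i j)
    show ?case
      using step.IH edge[OF step.hyps(2)] by (rule connected_component_trans)
  qed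
qed

text \<open>Every point of the union is joined to a centre inside its ball, so each component is the
  component of some observation, and paths in the proximity graph determine its members.\<close>

lemma clusters_eq:
  fixes x :: "nat \<Rightarrow> 'a::real_normed_vector"
  assumes r: "0 \<le> r"
  shows "clusters n x r = (`) x ` index_blocks n x r"
proof -
  let ?U = "\<Union>k\<in>{1..n}. cball (x k) (r / 2)"
  have comp: "x ` {1..n} \<inter> connected_component_set ?U (x k) = x ` ((proximity n x r)\<^sup>+ `` {k})"
    if k: "k \<in> {1..n}" for k
  proof -
    have "(proximity n x r)\<^sup>+ \<subseteq> {1..n} \<times> {1..n}"
      by (rule trancl_subset_Sigma) (auto simp: proximity_def)
    then have "l \<in> (proximity n x r)\<^sup>+ `` {k} \<longleftrightarrow>
        l \<in> {1..n} \<and> x l \<in> connected_component_set ?U (x k)" for l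
      using connected_component_cballs_iff[OF r k, of l x] by blast
    then show ?thesis
      by blast
  qed
  have "connected_component_set ?U ` ?U = (\<lambda>k. connected_component_set ?U (x k)) ` {1..n}"
  proof (intro equalityI subsetI)
    fix C assume "C \<in> connected_component_set ?U ` ?U"
    then obtain y k where y: "C = connected_component_set ?U y" "k \<in> {1..n}" "y \<in> cball (x k) (r / 2)"
      by blast
    have "connected_component ?U (x k) y"
    proof (rule connected_componentI)
      show "connected (cball (x k) (r / 2))"
        by (rule convex_connected) (rule convex_cball)
      show "cball (x k) (r / 2) \<subseteq> ?U"
        using y(2) by blast
    qed (use y(3) r in auto)
    then have "connected_component_set ?U y = connected_component_set ?U (x k)"
      by (intro connected_component_eq) simp
    with y(1) have "C = connected_component_set ?U (x k)"
      by metis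
    then show "C \<in> (\<lambda>k. connected_component_set ?U (x k)) ` {1..n}"
      using y by blast
  next
    fix C assume "C \<in> (\<lambda>k. connected_component_set ?U (x k)) ` {1..n}"
    then obtain k where k: "k \<in> {1..n}" "C = connected_component_set ?U (x k)"
      by blast
    have "x k \<in> cball (x k) (r / 2)"
      using r by simp
    then have "x k \<in> ?U"
      using k(1) by blast
    then show "C \<in> connected_component_set ?U ` ?U"
      using k(2) by blast
  qed
  then have "clusters n x r = (\<lambda>k. x ` {1..n} \<inter> connected_component_set ?U (x k)) ` {1..n}"
    by (simp add: clusters_def components_def sample_points_def image_image)
  also have "\<dots> = (\<lambda>k. x ` ((proximity n x r)\<^sup>+ `` {k})) ` {1..n}"
    using comp by (intro image_cong) auto
  also have "\<dots> = (`) x ` index_blocks n x r"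
    by (auto simp: index_blocks_def quotient_def)
  finally show ?thesis .
qed

text \<open>Coinciding observations are within distance \<open>r\<close>, hence lie in the same block.\<close>

lemma index_block_saturated:
  assumes r: "0 \<le> r" and I: "I \<in> index_blocks n x r"
  shows "{k \<in> {1..n}. x k \<in> x ` I} = I"
proof
  interpret finite_partition "{1..n}" "index_blocks n x r"
    using r by (rule finite_partition_index_blocks)
  show "I \<subseteq> {k \<in> {1..n}. x k \<in> x ` I}"
    using block_subset[OF I] by blast
  show "{k \<in> {1..n}. x k \<in> x ` I} \<subseteq> I"
  proof clarify
    fix k l assume k: "k \<in> {1..n}" "l \<in> I" "x k = x l"
    then have "(l, k) \<in> proximity n x r"
      using block_subset[OF I] r by (auto simp: proximity_def)
    then show "k \<in> I"
      using I k(2) equiv_trancl_proximity[OF r, of n x] unfolding index_blocks_def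
      by (meson in_quotient_imp_closed r_into_trancl)
  qed
qed

section \<open>Sizes, ranks and main clusters read off the blocks\<close>

context
  fixes n :: nat and x :: "nat \<Rightarrow> 'a::real_normed_vector" and r :: real
  assumes r: "0 \<le> r"
begin

interpretation finite_partition "{1..n}" "index_blocks n x r"
  using r by (rule finite_partition_index_blocks)

lemma inj_on_image_index_blocks: "inj_on ((`) x) (index_blocks n x r)"
  by (rule inj_onI) (metis index_block_saturated[OF r])

lemma card_clusters: "card (clusters n x r) = card (index_blocks n x r)"
  using clusters_eq[OF r] card_image[OF inj_on_image_index_blocks] by metis

lemma sample_size_image_block:
  "I \<in> index_blocks n x r \<Longrightarrow> sample_size n x (x ` I) = card I"
  using index_block_saturated[OF r, of I n x] by (simp add: sample_size_def)

lemma precedes_image_iff: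
  "I \<in> index_blocks n x r \<Longrightarrow> J \<in> index_blocks n x r \<Longrightarrow>
    precedes n x (x ` I) (x ` J) \<longleftrightarrow> ranked_before I J"
  using index_block_saturated[OF r, of I n x] index_block_saturated[OF r, of J n x]
  by (simp add: precedes_def ranked_before_def sample_size_def first_index_def)

lemma cluster_rank:
  assumes "I \<in> index_blocks n x r"
  shows "Suc (card {B \<in> clusters n x r. precedes n x B (x ` I)}) = block_rank (index_blocks n x r) I"
proof -
  have "{B \<in> clusters n x r. precedes n x B (x ` I)} =
      (`) x ` {J \<in> index_blocks n x r. ranked_before J I}"
    using precedes_image_iff assms by (auto simp: clusters_eq[OF r])
  also have "card \<dots> = card {J \<in> index_blocks n x r. ranked_before J I}"
    by (rule card_image) (rule inj_on_subset[OF inj_on_image_index_blocks], auto)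
  finally show ?thesis
    by (simp add: block_rank_def)
qed

text \<open>Rank \<open>0\<close> is excluded because there \<open>nth_cluster\<close> is an
  unspecified \<open>THE\<close>, while \<open>nth_block\<close> is empty.\<close>

lemma main_cluster_eq:
  assumes "1 \<le> m"
  shows "main_cluster n x r m = x ` nth_block (index_blocks n x r) m"
proof (cases "m \<le> card (index_blocks n x r)")
  case True
  then have m: "m \<in> {1..card (index_blocks n x r)}"
    using assms by auto
  have "nth_cluster n x r m = x ` nth_block (index_blocks n x r) m"
    unfolding nth_cluster_def
  proof (rule the_equality, goal_cases)
    case 1
    then show ?case
      using nth_block_in[OF m] cluster_rank by (auto simp: clusters_eq[OF r])
  next
    case (2 C)
    then obtain I where "I \<in> index_blocks n x r" "C = x ` I"
      by (auto simp: clusters_eq[OF r])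
    then show ?case
      using 2 cluster_rank nth_block_rank by metis
  qed
  then show ?thesis
    using True by (simp add: main_cluster_def card_clusters)
next
  case False
  then show ?thesis
    using nth_block_empty[of m] by (simp add: main_cluster_def card_clusters)
qed

lemma mem_main_cluster_iff:
  assumes "1 \<le> m" "k \<in> {1..n}"
  shows "x k \<in> main_cluster n x r m \<longleftrightarrow> k \<in> nth_block (index_blocks n x r) m"
proof (cases "nth_block (index_blocks n x r) m = {}")
  case False
  then have "nth_block (index_blocks n x r) m \<in> index_blocks n x r"
    using nth_block_nonempty_in by blast
  then have "k \<in> {k \<in> {1..n}. x k \<in> x ` nth_block (index_blocks n x r) m} \<longleftrightarrow>
      k \<in> nth_block (index_blocks n x r) m"
    by (simp only: index_block_saturated[OF r])
  then show ?thesis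
    using assms(2) by (simp add: main_cluster_eq[OF assms(1)])
qed (use main_cluster_eq assms in auto)

lemma sample_size_main_cluster:
  assumes "1 \<le> m"
  shows "sample_size n x (main_cluster n x r m) = card (nth_block (index_blocks n x r) m)"
proof (cases "nth_block (index_blocks n x r) m = {}")
  case False
  then have "nth_block (index_blocks n x r) m \<in> index_blocks n x r"
    using nth_block_nonempty_in by blast
  then show ?thesis
    using sample_size_image_block main_cluster_eq[OF assms(1)] by simp
qed (use main_cluster_eq assms in \<open>auto simp: sample_size_def\<close>)

text \<open>The passage from points to indices. Permutations of \<open>{1..M}\<close> only produce
  ranks at least \<open>1\<close>, for which membership in a main cluster and in its block
  agree.\<close>

lemma sample_captured_iff:
  "(\<exists>\<pi>. \<pi> permutes {1..M} \<and>
      (\<forall>i\<in>{1..M}. sample_points n x \<inter> S i \<subseteq> main_cluster n x r (\<pi> i))) \<longleftrightarrow>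
    captures M (\<lambda>i. {k \<in> {1..n}. x k \<in> S i}) (index_blocks n x r)"
proof -
  have "sample_points n x \<inter> S i \<subseteq> main_cluster n x r (\<pi> i) \<longleftrightarrow>
      {k \<in> {1..n}. x k \<in> S i} \<subseteq> nth_block (index_blocks n x r) (\<pi> i)"
    if "\<pi> permutes {1..M}" "i \<in> {1..M}" for \<pi> i
  proof -
    have "1 \<le> \<pi> i"
      using that permutes_in_image by fastforce
    then show ?thesis
      using mem_main_cluster_iff[of "\<pi> i"] unfolding sample_points_def by blast
  qed
  then show ?thesis
    unfolding captures_def by blast
qed

end

subsection \<open>Selected radius\<close>

lemma main_cluster_cong:
  "clusters n x r = clusters n x s \<Longrightarrow> main_cluster n x r = main_cluster n x s"
  by (simp add: main_cluster_def nth_cluster_def fun_eq_iff)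

text \<open>A change radius is the first one with its partition, so \<open>clusters n x\<close> is
  injective on these radii, and there are only finitely many families of subsets of the
  sample.\<close>

lemma finite_change_radii: "finite (change_radii n x)"
proof (rule finite_imageD)
  have "range (clusters n x) \<subseteq> Pow (Pow (sample_points n x))"
    by (auto simp: clusters_def)
  then show "finite (clusters n x ` change_radii n x)"
    by (rule finite_subset[OF order_trans[OF image_mono[OF subset_UNIV]]]) (simp add: sample_points_def)
  show "inj_on (clusters n x) (change_radii n x)"
  proof (rule linorder_inj_onI)
    fix r s assume "r < s" "r \<in> change_radii n x" "s \<in> change_radii n x"
    then show "clusters n x r \<noteq> clusters n x s"
      by (auto simp: change_radii_def)
  qed auto
qed

text \<open>
  Clusters at \<open>s\<close> only depend on which of the finitely many interpoint distances are at most \<open>s\<close>,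
  so the least radius with a given partition is attained at one of these distances or at \<open>0\<close>.
\<close>

lemma representative_radius:
  fixes x :: "nat \<Rightarrow> 'a::real_normed_vector"
  assumes "0 \<le> r"
  obtains \<rho> where "\<rho> \<in> insert 0 (change_radii n x)" "\<rho> \<le> r" "clusters n x \<rho> = clusters n x r"
proof -
  define D where "D = insert 0 ((\<lambda>(k, l). dist (x k) (x l)) ` ({1..n} \<times> {1..n}))"
  have D: "finite D" "0 \<in> D" "\<And>d. d \<in> D \<Longrightarrow> 0 \<le> d"
    by (auto simp: D_def)
  have below: "\<exists>d\<in>D. d \<le> s \<and> clusters n x d = clusters n x s" if s: "0 \<le> s" for s
  proof -
    define d where "d = Max {d \<in> D. d \<le> s}"
    have fin: "finite {d \<in> D. d \<le> s}" "{d \<in> D. d \<le> s} \<noteq> {}"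
      using D s by auto
    have d: "d \<in> D" "d \<le> s"
      using Max_in[OF fin] by (auto simp: d_def)
    have "dist (x k) (x l) \<le> d" if "k \<in> {1..n}" "l \<in> {1..n}" "dist (x k) (x l) \<le> s" for k l
    proof -
      have "dist (x k) (x l) \<in> D"
        using that unfolding D_def by (intro insertI2 image_eqI[of _ _ "(k, l)"]) auto
      then show ?thesis
        using fin that by (auto simp: d_def intro: Max_ge)
    qed
    then have "proximity n x d = proximity n x s"
      using d(2) by (auto simp: proximity_def)
    then have "clusters n x d = clusters n x s"
      using s D(3)[OF d(1)] by (simp add: clusters_eq index_blocks_def)
    then show ?thesis
      using d by blast
  qed
  define F where "F = {d \<in> D. d \<le> r \<and> clusters n x d = clusters n x r}"
  define \<rho> where "\<rho> = Min F"
  have F: "finite F" "F \<noteq> {}"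
    using D below[OF assms] by (auto simp: F_def)
  then have \<rho>: "\<rho> \<in> F"
    by (simp add: \<rho>_def)
  \<comment> \<open>An earlier radius with the same partition could be lowered to an element of
    \<open>D\<close> by \<open>below\<close>, contradicting the minimality of \<open>\<rho>\<close>
    in \<open>F\<close>.\<close>
  have "clusters n x s \<noteq> clusters n x \<rho>" if s: "0 \<le> s" "s < \<rho>" for s
  proof
    assume "clusters n x s = clusters n x \<rho>"
    moreover obtain d where d: "d \<in> D" "d \<le> s" "clusters n x d = clusters n x s"
      using below[OF s(1)] by blast
    ultimately have "d \<in> F"
      using \<rho> s(2) by (auto simp: F_def)
    then have "\<rho> \<le> d"
      using F(1) by (simp add: \<rho>_def)
    then show False
      using d(2) s(2) by simp
  qed
  then have "\<rho> \<in> insert 0 (change_radii n x)"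
    using \<rho> D(3) by (force simp: change_radii_def F_def)
  then show thesis
    using \<rho> that by (auto simp: F_def)
qed

lemma (in finite_partition) refines_singleton_imp_card_le_1:
  assumes "refines V Q' Q" "card Q' \<le> 1"
  shows "card Q \<le> 1"
proof -
  interpret Q': finite_partition V Q'
    using finite_partition_refines(1)[OF fin assms(1)] .
  have "I = I'" if I: "I \<in> Q" "I' \<in> Q" for I I'
  proof -
    obtain k k' where k: "k \<in> I" "k' \<in> I'"
      using I block_nonempty by blast
    then have "k \<in> V" "k' \<in> V"
      using I block_subset by auto
    then obtain A A' where A: "A \<in> Q'" "k \<in> A" "A' \<in> Q'" "k' \<in> A'"
      using Q'.part by (auto simp: partition_on_def)
    then have "A = A'"
      using assms(2) Q'.finite_Q card_le_Suc0_iff_eq by (metis One_nat_def)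
    moreover obtain J where "J \<in> Q" "A \<subseteq> J"
      using assms(1) A(1) by (auto simp: refines_def)
    ultimately show ?thesis
      using A k I block_eqI by blast
  qed
  then show ?thesis
    using finite_Q by (simp add: card_le_Suc0_iff_eq)
qed

text \<open>Only the largest radius is discarded. Some radius \<open>\<rho>'\<close> in the list has
  at most one cluster, and as clusters only merge, a radius with two clusters lies strictly below
  it.\<close>

lemma candidate_radiiI:
  fixes x :: "nat \<Rightarrow> 'a::real_normed_vector"
  assumes "\<rho> \<in> insert 0 (change_radii n x)" "2 \<le> card (clusters n x \<rho>)"
  shows "\<rho> \<in> candidate_radii n x"
proof -
  \<comment> \<open>A crude bound for all interpoint distances, which also makes sense for an empty
    sample.\<close>
  define s where "s = (\<Sum>k\<in>{1..n}. \<Sum>l\<in>{1..n}. dist (x k) (x l))"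
  have s: "0 \<le> s"
    by (auto simp: s_def intro!: sum_nonneg)
  have "dist (x k) (x l) \<le> s" if "k \<in> {1..n}" "l \<in> {1..n}" for k l
  proof -
    have "dist (x k) (x l) \<le> (\<Sum>l\<in>{1..n}. dist (x k) (x l))"
      using that by (intro member_le_sum) auto
    also have "\<dots> \<le> s"
      unfolding s_def using that by (intro member_le_sum) (auto intro: sum_nonneg)
    finally show ?thesis .
  qed
  then have "{1..n} \<times> {1..n} \<subseteq> (proximity n x s)\<^sup>+"
    by (auto simp: proximity_def)
  then have "I = {1..n}" if "I \<in> index_blocks n x s" for I
    using that equiv_trancl_proximity[OF s, of n x] unfolding index_blocks_def
    by (auto simp: quotient_def equiv_def)
  then have "card (index_blocks n x s) \<le> card {{1..n}}"
    by (intro card_mono) auto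
  then have "card (clusters n x s) \<le> 1"
    by (simp add: card_clusters[OF s])
  then obtain \<rho>' where \<rho>': "\<rho>' \<in> insert 0 (change_radii n x)" "card (clusters n x \<rho>') \<le> 1"
    using representative_radius[OF s, of n x] by metis
  have nonneg: "0 \<le> \<rho>" "0 \<le> \<rho>'"
    using assms(1) \<rho>'(1) by (auto simp: change_radii_def)
  interpret finite_partition "{1..n}" "index_blocks n x \<rho>"
    using finite_partition_index_blocks[OF nonneg(1)] .
  have "\<not> \<rho>' \<le> \<rho>"
  proof
    assume "\<rho>' \<le> \<rho>"
    then have "card (index_blocks n x \<rho>) \<le> 1"
      using \<rho>'(2) unfolding card_clusters[OF nonneg(2)]
      by (intro refines_singleton_imp_card_le_1[OF index_blocks_refines[OF nonneg(2)]])
    then show False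
      using assms(2) by (simp add: card_clusters[OF nonneg(1)])
  qed
  then have "\<rho> \<noteq> Max (insert 0 (change_radii n x))"
    using \<rho>'(1) finite_change_radii by (metis Max_ge finite.insertI)
  then show ?thesis
    using assms(1) by (simp add: candidate_radii_def)
qed

lemma selected_radius_is_last_arg_max:
  fixes M n :: nat and x :: "nat \<Rightarrow> 'a::metric_space"
  assumes "candidate_radii n x \<noteq> {}"
  defines "f \<equiv> \<lambda>\<rho>. sample_size n x (main_cluster n x \<rho> M)"
  shows "selected_radius M n x \<in> candidate_radii n x"
    and "\<rho> \<in> candidate_radii n x \<Longrightarrow> f \<rho> \<le> f (selected_radius M n x)"
    and "\<rho> \<in> candidate_radii n x \<Longrightarrow> f (selected_radius M n x) \<le> f \<rho> \<Longrightarrow> \<rho> \<le> selected_radius M n x"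
proof -
  let ?C = "candidate_radii n x"
  let ?A = "{\<rho>. is_arg_max f (\<lambda>\<rho>. \<rho> \<in> ?C) \<rho>}"
  have sel: "selected_radius M n x = Max ?A"
    using assms by (simp add: selected_radius_def)
  have fin: "finite ?C"
    using finite_change_radii by (simp add: candidate_radii_def)
  have "Max (f ` ?C) \<in> f ` ?C"
    using fin assms(1) by (intro Max_in) auto
  then obtain \<rho>0 where "\<rho>0 \<in> ?C" "f \<rho>0 = Max (f ` ?C)"
    by auto
  then have "\<rho>0 \<in> ?A"
    using fin by (auto simp: is_arg_max_linorder)
  moreover have finA: "finite ?A"
    by (rule finite_subset[OF _ fin]) (auto simp: is_arg_max_def)
  ultimately have "Max ?A \<in> ?A"
    by (intro Max_in) auto
  then have A: "Max ?A \<in> ?C" "\<And>\<rho>. \<rho> \<in> ?C \<Longrightarrow> f \<rho> \<le> f (Max ?A)"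
    by (auto simp: is_arg_max_linorder)
  then show "selected_radius M n x \<in> ?C" "\<rho> \<in> ?C \<Longrightarrow> f \<rho> \<le> f (selected_radius M n x)"
    by (simp_all add: sel)
  assume "\<rho> \<in> ?C" "f (selected_radius M n x) \<le> f \<rho>"
  then have "\<rho> \<in> ?A"
    using A by (auto simp: is_arg_max_linorder sel intro: order_trans)
  then show "\<rho> \<le> selected_radius M n x"
    using finA by (simp add: sel)
qed

text \<open>The successful \<open>r\<close> need not be a candidate, so the comparison is made with
  the first radius \<open>\<rho>\<close> having the same partition. Maximality gives the selected
  radius an \<open>M\<close>-th block of size at least \<open>b\<close>, as both comparison lemmas
  require.\<close>

lemma captures_selected_radius:
  fixes M n :: nat and x :: "nat \<Rightarrow> 'a::real_normed_vector" and S :: "nat \<Rightarrow> 'a set" and b :: real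
  defines "N \<equiv> \<lambda>i. {k \<in> {1..n}. x k \<in> S i}"
  assumes M: "2 \<le> M" and r: "0 \<le> r"
    and cap: "captures M N (index_blocks n x r)"
    and large: "\<And>i. i \<in> {1..M} \<Longrightarrow> b \<le> card (N i)"
    and noise: "card ({1..n} - (\<Union>i\<in>{1..M}. N i)) < b"
    and small: "\<And>i. i \<in> {1..M} \<Longrightarrow>
      card (N i) + card ({1..n} - (\<Union>i\<in>{1..M}. N i)) < 2 * b"
  shows "captures M N (index_blocks n x (selected_radius M n x))"
proof -
  define f where "f = (\<lambda>\<rho>. sample_size n x (main_cluster n x \<rho> M))"
  have f: "f \<rho> = card (nth_block (index_blocks n x \<rho>) M)" if "0 \<le> \<rho>" for \<rho>
    using M that by (simp add: f_def sample_size_main_cluster)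
  have N_sub: "N i \<subseteq> {1..n}" for i
    by (auto simp: N_def)
  have N_ne: "N i \<noteq> {}" if "i \<in> {1..M}" for i
    using large[OF that] noise by fastforce
  obtain \<rho> where \<rho>: "\<rho> \<in> insert 0 (change_radii n x)" "\<rho> \<le> r" "clusters n x \<rho> = clusters n x r"
    using representative_radius[OF r] .
  have \<rho>_nonneg: "0 \<le> \<rho>"
    using \<rho>(1) by (auto simp: change_radii_def)
  have cap_\<rho>: "captures M N (index_blocks n x \<rho>)"
    using cap sample_captured_iff[OF r, of M n x S] sample_captured_iff[OF \<rho>_nonneg, of M n x S]
      main_cluster_cong[OF \<rho>(3)] by (simp add: N_def)
  interpret R: finite_partition "{1..n}" "index_blocks n x \<rho>"
    using finite_partition_index_blocks[OF \<rho>_nonneg] .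
  obtain i where i: "i \<in> {1..M}" "card (N i) \<le> card (nth_block (index_blocks n x \<rho>) M)"
    using R.captures_imp_card_nth_block_ge[OF cap_\<rho>] M by auto
  then have b_le: "b \<le> f \<rho>"
    using large[OF i(1)] f[OF \<rho>_nonneg] by auto
  then have "nth_block (index_blocks n x \<rho>) M \<noteq> {}"
    using noise f[OF \<rho>_nonneg] by fastforce
  \<comment> \<open>A nonempty block of rank \<open>M\<close> means at least
    \<open>M \<ge> 2\<close> clusters, so \<open>\<rho>\<close> is not the discarded last
    radius.\<close>
  then have "2 \<le> card (clusters n x \<rho>)"
    using R.nth_block_empty M unfolding card_clusters[OF \<rho>_nonneg] by fastforce
  then have cand: "\<rho> \<in> candidate_radii n x"
    by (rule candidate_radiiI[OF \<rho>(1)])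
  define s where "s = selected_radius M n x"
  have s: "s \<in> candidate_radii n x" "f \<rho> \<le> f s" "f s \<le> f \<rho> \<Longrightarrow> \<rho> \<le> s"
    using selected_radius_is_last_arg_max[of n x] cand unfolding s_def f_def by blast+
  have s_nonneg: "0 \<le> s"
    using s(1) by (auto simp: candidate_radii_def change_radii_def)
  have b_le_s: "b \<le> card (nth_block (index_blocks n x s) M)"
    using b_le s(2) f[OF s_nonneg] by linarith
  then have big: "card ({1..n} - (\<Union>i\<in>{1..M}. N i)) < card (nth_block (index_blocks n x s) M)"
    using noise by linarith
  \<comment> \<open>If \<open>s < \<rho>\<close>, the partition at \<open>s\<close> is finer and its
    \<open>M\<close>-th block no larger than at \<open>\<rho>\<close>; both radii then attain the
    maximum, and the tie rule yields \<open>\<rho> \<le> s\<close> after all.\<close>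
  have "\<rho> \<le> s"
  proof (rule ccontr)
    assume "\<not> \<rho> \<le> s"
    then have "refines {1..n} (index_blocks n x s) (index_blocks n x \<rho>)"
      by (intro index_blocks_refines s_nonneg) simp
    moreover have "card (N i) + card ({1..n} - (\<Union>i\<in>{1..M}. N i)) <
        2 * card (nth_block (index_blocks n x s) M)" if "i \<in> {1..M}" for i
      using small[OF that] b_le_s by linarith
    ultimately have "f s \<le> f \<rho>"
      using captures_finer_card_le[OF _ _ cap_\<rho> N_sub _ big] M f s_nonneg \<rho>_nonneg by auto
    with s(3) \<open>\<not> \<rho> \<le> s\<close> show False
      by simp
  qed
  then show ?thesis
    using captures_coarser[OF _ index_blocks_refines[OF \<rho>_nonneg] cap_\<rho> N_ne big]
    by (simp add: s_def)
qed

subsection \<open>Concentration and measurability\<close>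

text \<open>This is \<open>ln u < u - 1\<close> for \<open>u \<noteq> 1\<close>, taken at
  \<open>u = 1 / (1 + t)\<close> and multiplied by \<open>1 + t\<close>.\<close>

lemma psi_pos:
  assumes "0 < t"
  shows "0 < psi t"
proof -
  have "ln (inverse (1 + t)) < inverse (1 + t) - 1"
    using assms ln_le_minus_one[of "inverse (1 + t)"] ln_eq_minus_one[of "inverse (1 + t)"]
    by fastforce
  then have "(1 + t) * (1 - inverse (1 + t)) < (1 + t) * ln (1 + t)"
    using assms by (intro mult_strict_left_mono) (auto simp: ln_inverse)
  moreover have "(1 + t) * (1 - inverse (1 + t)) = t"
    using assms by (simp add: field_simps)
  ultimately show ?thesis
    by (simp add: psi_def algebra_simps)
qed

text \<open>The difference vanishes at \<open>0\<close> and has derivative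
  \<open>- ln (1 - u) - ln (1 + u)\<close>, which is nonnegative. It lets the upper-tail rate serve
  for the lower tail as well.\<close>

lemma psi_le_psi_uminus:
  assumes "0 \<le> t" "t < 1"
  shows "psi t \<le> psi (- t)"
proof -
  let ?f = "\<lambda>t::real. (1 - t) * ln (1 - t) - (1 + t) * ln (1 + t) + 2 * t"
  have "?f 0 \<le> ?f t"
  proof (rule DERIV_nonneg_imp_nondecreasing[OF assms(1)])
    fix u assume u: "0 \<le> u" "u \<le> t"
    have "((\<lambda>t. (1 - t) * ln (1 - t)) has_real_derivative - ln (1 - u) - 1) (at u)"
      using u assms(2) by (auto intro!: derivative_eq_intros)
    moreover have "((\<lambda>t. (1 + t) * ln (1 + t)) has_real_derivative ln (1 + u) + 1) (at u)"
      using u by (auto intro!: derivative_eq_intros)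
    ultimately have "(?f has_real_derivative - ln (1 - u) - ln (1 + u)) (at u)"
      using DERIV_add[OF DERIV_diff DERIV_cmult[OF DERIV_ident, of 2]] by fastforce
    moreover have "ln (1 - u) + ln (1 + u) \<le> 0"
      using ln_le_minus_one[of "1 - u"] ln_le_minus_one[of "1 + u"] u assms(2) by simp
    ultimately show "\<exists>y. (?f has_real_derivative y) (at u) \<and> 0 \<le> y"
      by (intro exI[of _ "- ln (1 - u) - ln (1 + u)"]) auto
  qed
  then show ?thesis
    by (simp add: psi_def algebra_simps)
qed

section \<open>Chernoff bounds for counts\<close>

context prob_space
begin

text \<open>
  Chernoff's method with Laplace parameter \<open>ln s\<close>, which is optimal for deviations of the count
  to \<open>s\<close> times its mean; \<open>s > 1\<close> gives the upper and \<open>s < 1\<close> the lower tail.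
\<close>

lemma chernoff_count:
  fixes X :: "'i \<Rightarrow> 'a \<Rightarrow> 'b::topological_space" and s p :: real
  assumes I: "finite I" and indep: "indep_vars (\<lambda>_. borel) X I" and A: "A \<in> sets borel"
    and p: "\<And>k. k \<in> I \<Longrightarrow> prob (X k -` A \<inter> space M) = p" and s: "0 < s"
  shows "prob {\<omega> \<in> space M. ln s * (s * (card I * p)) \<le> ln s * card {k \<in> I. X k \<omega> \<in> A}}
    \<le> exp (- psi (s - 1) * (card I * p))"
proof -
  \<comment> \<open>\<open>Z k\<close> is \<open>s\<close> to the power of the indicator, so the
    product over \<open>k\<close> is \<open>s\<close> to the power of the count, and its expectation
    factorises.\<close>
  define Z where "Z = (\<lambda>k \<omega>. if X k \<omega> \<in> A then s else 1)"
  let ?\<mu> = "card I * p"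
  have X [measurable]: "X k \<in> borel_measurable M" if "k \<in> I" for k
    using indep that by (auto simp: indep_vars_def)
  have Z_eq: "Z k \<omega> = 1 + (s - 1) * indicator (X k -` A \<inter> space M) \<omega>" if "\<omega> \<in> space M" for k \<omega>
    using that by (auto simp: Z_def)
  have ev: "X k -` A \<inter> space M \<in> events" if "k \<in> I" for k
    using measurable_sets[OF X[OF that] A] .
  have int: "integrable M (Z k)" if "k \<in> I" for k
  proof -
    have "integrable M (\<lambda>\<omega>. 1 + (s - 1) * indicator (X k -` A \<inter> space M) \<omega>)"
      using ev[OF that] by (intro Bochner_Integration.integrable_add integrable_mult_right integrable_const) (auto simp: emeasure_eq_measure)
    then show ?thesis
      using Z_eq by (subst Bochner_Integration.integrable_cong[where M=M and N=M and g = "\<lambda>\<omega>. 1 + (s - 1) * indicator (X k -` A \<inter> space M) \<omega>"]) auto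
  qed
  have exp_Z: "expectation (Z k) = 1 + (s - 1) * p" if "k \<in> I" for k
  proof -
    have "expectation (Z k) = expectation (\<lambda>\<omega>. 1 + (s - 1) * indicator (X k -` A \<inter> space M) \<omega>)"
      using Z_eq by (intro Bochner_Integration.integral_cong) auto
    also have "\<dots> = 1 + (s - 1) * p"
      using ev[OF that] p[OF that]
      by (subst Bochner_Integration.integral_add) (auto simp: prob_space emeasure_eq_measure)
    finally show ?thesis .
  qed
  have indep_Z: "indep_vars (\<lambda>_. borel) Z I"
    unfolding Z_def using indep A by (intro indep_vars_compose2[OF indep]) auto
  have prod_Z: "(\<Prod>k\<in>I. Z k \<omega>) = exp (ln s * card {k \<in> I. X k \<omega> \<in> A})" for \<omega>
  proof -
    have "(\<Prod>k\<in>I. Z k \<omega>) = s ^ card {k \<in> I. X k \<omega> \<in> A}"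
      using I by (simp add: Z_def prod.If_cases Collect_conj_eq Int_commute)
    also have "\<dots> = exp (ln s * card {k \<in> I. X k \<omega> \<in> A})"
      using s by (simp add: exp_of_nat2_mult)
    finally show ?thesis .
  qed
  have int_prod: "integrable M (\<lambda>\<omega>. \<Prod>k\<in>I. Z k \<omega>)"
    using indep_vars_integrable[OF I indep_Z] int by auto
  have exp_prod: "expectation (\<lambda>\<omega>. \<Prod>k\<in>I. Z k \<omega>) = (1 + (s - 1) * p) ^ card I"
    using indep_vars_lebesgue_integral[OF I indep_Z] int exp_Z by simp
  have exp_le: "expectation (\<lambda>\<omega>. \<Prod>k\<in>I. Z k \<omega>) \<le> exp (?\<mu> * (s - 1))"
  \<comment> \<open>For empty \<open>I\<close> nothing ties \<open>p\<close> to a probability;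
    \<open>0 \<le> p \<le> 1\<close> is available only in the other case.\<close>
  proof (cases "I = {}")
    case True
    then show ?thesis
      by (simp add: prob_space)
  next
    case False
    then obtain k where k: "k \<in> I"
      by auto
    have "0 \<le> p" "p \<le> 1"
      using p[OF k] measure_nonneg prob_le_1 by metis+
    \<comment> \<open>The base of the power is a convex combination of \<open>1\<close> and
      \<open>s\<close>; its sign is needed before raising \<open>1 + u \<le> exp u\<close> to a
      power.\<close>
    then have "0 \<le> (1 - p) + s * p"
      using s by (intro add_nonneg_nonneg mult_nonneg_nonneg) auto
    then have "0 \<le> 1 + (s - 1) * p"
      by (simp add: algebra_simps)
    then have "(1 + (s - 1) * p) ^ card I \<le> exp ((s - 1) * p) ^ card I"
      by (intro power_mono) auto
    then show ?thesis
      unfolding exp_prod by (simp add: exp_of_nat_mult[symmetric] mult_ac)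
  qed
  have "prob {\<omega> \<in> space M. ln s * (s * ?\<mu>) \<le> ln s * card {k \<in> I. X k \<omega> \<in> A}} =
      prob {\<omega> \<in> space M. exp (ln s * (s * ?\<mu>)) \<le> (\<Prod>k\<in>I. Z k \<omega>)}"
    unfolding prod_Z by simp
  also have "\<dots> \<le> expectation (\<lambda>\<omega>. \<Prod>k\<in>I. Z k \<omega>) / exp (ln s * (s * ?\<mu>))"
    using s by (intro integral_Markov_inequality_measure[OF int_prod, of "{}"])
      (auto simp: Z_def intro!: prod_nonneg)
  also have "\<dots> \<le> exp (?\<mu> * (s - 1)) / exp (ln s * (s * ?\<mu>))"
    using exp_le by (intro divide_right_mono) auto
  \<comment> \<open>This rests on \<open>psi (s - 1) = s ln s - s + 1\<close>.\<close>
  also have "\<dots> = exp (- psi (s - 1) * ?\<mu>)"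
    unfolding exp_diff[symmetric] by (simp add: psi_def algebra_simps)
  finally show ?thesis .
qed

lemma measurable_count:
  fixes X :: "'i \<Rightarrow> 'a \<Rightarrow> 'b::topological_space"
  assumes "finite I" "\<And>k. k \<in> I \<Longrightarrow> X k \<in> borel_measurable M" "A \<in> sets borel"
  shows "(\<lambda>\<omega>. real (card {k \<in> I. X k \<omega> \<in> A})) \<in> borel_measurable M"
proof -
  have "real (card {k \<in> I. X k \<omega> \<in> A}) = (\<Sum>k\<in>I. indicator A (X k \<omega>))" for \<omega>
    using assms(1) by (simp add: indicator_def sum.If_cases Collect_conj_eq Int_commute)
  moreover have "(\<lambda>\<omega>. \<Sum>k\<in>I. indicator A (X k \<omega>) :: real) \<in> borel_measurable M"
    using assms by (intro borel_measurable_sum measurable_compose[OF _ borel_measurable_indicator]) auto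
  ultimately show ?thesis
    by simp
qed

lemma chernoff_count_two_sided:
  fixes X :: "'i \<Rightarrow> 'a \<Rightarrow> 'b::topological_space" and \<eta> p :: real
  assumes I: "finite I" and indep: "indep_vars (\<lambda>_. borel) X I" and A: "A \<in> sets borel"
    and p: "\<And>k. k \<in> I \<Longrightarrow> prob (X k -` A \<inter> space M) = p" "0 \<le> p" and \<eta>: "0 < \<eta>" "\<eta> < 1"
  shows "prob {\<omega> \<in> space M. \<eta> * (card I * p) < \<bar>card {k \<in> I. X k \<omega> \<in> A} - card I * p\<bar>}
    \<le> 2 * exp (- psi \<eta> * (card I * p))"
proof -
  let ?\<mu> = "card I * p" and ?c = "\<lambda>\<omega>. real (card {k \<in> I. X k \<omega> \<in> A})"
  let ?E = "\<lambda>s. {\<omega> \<in> space M. ln s * (s * ?\<mu>) \<le> ln s * ?c \<omega>}"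
  have c [measurable]: "?c \<in> borel_measurable M"
    using I A indep by (intro measurable_count) (auto simp: indep_vars_def)
  \<comment> \<open>Since \<open>ln (1 - \<eta>) < 0\<close>, the event for
    \<open>1 - \<eta>\<close> says that the count is at most \<open>(1 - \<eta>)\<close> times its
    mean; outside it a large deviation must be upward.\<close>
  have sub: "{\<omega> \<in> space M. \<eta> * ?\<mu> < \<bar>?c \<omega> - ?\<mu>\<bar>} \<subseteq> ?E (1 + \<eta>) \<union> ?E (1 - \<eta>)"
  proof clarify
    fix \<omega> assume \<omega>: "\<omega> \<in> space M" "\<eta> * ?\<mu> < \<bar>?c \<omega> - ?\<mu>\<bar>"
    assume "\<not> ln (1 - \<eta>) * ((1 - \<eta>) * ?\<mu>) \<le> ln (1 - \<eta>) * ?c \<omega>"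
    then have "(1 - \<eta>) * ?\<mu> \<le> ?c \<omega>"
      using \<eta> mult_left_mono_neg[of "?c \<omega>" "(1 - \<eta>) * ?\<mu>" "ln (1 - \<eta>)"] by fastforce
    then have "(1 + \<eta>) * ?\<mu> \<le> ?c \<omega>"
      using \<omega>(2) by (simp add: algebra_simps abs_if split: if_splits)
    then show "ln (1 + \<eta>) * ((1 + \<eta>) * ?\<mu>) \<le> ln (1 + \<eta>) * ?c \<omega>"
      using \<eta> by (intro mult_left_mono) auto
  qed
  have "prob {\<omega> \<in> space M. \<eta> * ?\<mu> < \<bar>?c \<omega> - ?\<mu>\<bar>} \<le> prob (?E (1 + \<eta>) \<union> ?E (1 - \<eta>))"
    using sub by (intro finite_measure_mono) auto
  also have "\<dots> \<le> prob (?E (1 + \<eta>)) + prob (?E (1 - \<eta>))"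
    by (intro measure_Un_le) auto
  also have "prob (?E (1 + \<eta>)) \<le> exp (- psi \<eta> * ?\<mu>)"
    using chernoff_count[OF I indep A p(1), of "1 + \<eta>"] \<eta> by simp
  also have "prob (?E (1 - \<eta>)) \<le> exp (- psi (- \<eta>) * ?\<mu>)"
    using chernoff_count[OF I indep A p(1), of "1 - \<eta>"] \<eta> by simp
  also have "exp (- psi (- \<eta>) * ?\<mu>) \<le> exp (- psi \<eta> * ?\<mu>)"
    using psi_le_psi_uminus[of \<eta>] \<eta> p(2) by (auto intro!: mult_right_mono)
  finally show ?thesis
    by simp
qed

end

text \<open>Finitely many events have finitely many patterns of truth values, so any property
  \<open>Q\<close> of the pattern defines a finite union of measurable sets.\<close>

lemma sets_Collect_finite_pattern:
  assumes J: "finite J" and B: "\<And>j. j \<in> J \<Longrightarrow> {\<omega> \<in> space M. B j \<omega>} \<in> sets M"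
  shows "{\<omega> \<in> space M. Q {j \<in> J. B j \<omega>}} \<in> sets M"
proof -
  have "{\<omega> \<in> space M. Q {j \<in> J. B j \<omega>}} =
      (\<Union>T\<in>{T \<in> Pow J. Q T}. {\<omega> \<in> space M. \<forall>j\<in>J. B j \<omega> \<longleftrightarrow> j \<in> T})"
  proof (intro equalityI subsetI)
    fix \<omega> assume "\<omega> \<in> {\<omega> \<in> space M. Q {j \<in> J. B j \<omega>}}"
    then show "\<omega> \<in> (\<Union>T\<in>{T \<in> Pow J. Q T}. {\<omega> \<in> space M. \<forall>j\<in>J. B j \<omega> \<longleftrightarrow> j \<in> T})"
      by (intro UN_I[of "{j \<in> J. B j \<omega>}"]) auto
  next
    fix \<omega> assume "\<omega> \<in> (\<Union>T\<in>{T \<in> Pow J. Q T}. {\<omega> \<in> space M. \<forall>j\<in>J. B j \<omega> \<longleftrightarrow> j \<in> T})"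
    then obtain T where "T \<subseteq> J" "Q T" "\<omega> \<in> space M" "\<forall>j\<in>J. B j \<omega> \<longleftrightarrow> j \<in> T"
      by auto
    moreover from this have "{j \<in> J. B j \<omega>} = T"
      by auto
    ultimately show "\<omega> \<in> {\<omega> \<in> space M. Q {j \<in> J. B j \<omega>}}"
      by simp
  qed
  also have "\<dots> \<in> sets M"
  proof (rule sets.finite_UN)
    fix T
    have "{\<omega> \<in> space M. B j \<omega> \<longleftrightarrow> j \<in> T} \<in> sets M" if "j \<in> J" for j
      using B[OF that] sets.sets_Collect_neg[OF B[OF that]] by (cases "j \<in> T") auto
    then show "{\<omega> \<in> space M. \<forall>j\<in>J. B j \<omega> \<longleftrightarrow> j \<in> T} \<in> sets M"
      using J by (intro sets.sets_Collect_finite_All) auto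
  qed (use J in auto)
  finally show ?thesis .
qed

lemma captures_cong:
  "(\<And>i. i \<in> {1..M} \<Longrightarrow> N i = N' i) \<Longrightarrow> captures M N Q \<longleftrightarrow> captures M N' Q"
  by (simp add: captures_def)

text \<open>At a fixed radius, success depends only on which pairs are within \<open>r\<close> and
  which observations lie in which \<open>S i\<close>. These two kinds of yes-no events are collected
  in one index set, a disjoint sum.\<close>

lemma sets_Collect_captures:
  fixes X :: "nat \<Rightarrow> 'w \<Rightarrow> 'a::euclidean_space"
  assumes X: "\<And>k. k \<in> {1..n} \<Longrightarrow> X k \<in> borel_measurable \<Omega>"
    and S: "\<And>i. i \<in> {1..M} \<Longrightarrow> S i \<in> sets borel"
  shows "{\<omega> \<in> space \<Omega>. captures M (\<lambda>i. {k \<in> {1..n}. X k \<omega> \<in> S i})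
      (index_blocks n (\<lambda>k. X k \<omega>) r)} \<in> sets \<Omega>"
proof -
  let ?J = "({1..n} \<times> {1..n}) <+> ({1..M} \<times> {1..n})"
  define B where "B = case_sum (\<lambda>(k, l) \<omega>. dist (X k \<omega>) (X l \<omega>) \<le> r) (\<lambda>(i, k) \<omega>. X k \<omega> \<in> S i)"
  define Q where "Q = (\<lambda>T. captures M (\<lambda>i. {k \<in> {1..n}. Inr (i, k) \<in> T})
    ({1..n} // {(k, l). Inl (k, l) \<in> T}\<^sup>+))"
  have "{\<omega> \<in> space \<Omega>. B j \<omega>} \<in> sets \<Omega>" if "j \<in> ?J" for j
  proof (use that in \<open>elim PlusE\<close>)
    fix kl assume "kl \<in> {1..n} \<times> {1..n}" "j = Inl kl"
    then obtain k l where kl: "k \<in> {1..n}" "l \<in> {1..n}" "j = Inl (k, l)"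
      by auto
    note [measurable] = X[OF kl(1)] X[OF kl(2)]
    show ?thesis
      unfolding kl(3) B_def by simp
  next
    fix ik assume "ik \<in> {1..M} \<times> {1..n}" "j = Inr ik"
    then obtain i k where ik: "i \<in> {1..M}" "k \<in> {1..n}" "j = Inr (i, k)"
      by auto
    have "X k -` S i \<inter> space \<Omega> \<in> sets \<Omega>"
      using X[OF ik(2)] S[OF ik(1)] by (rule measurable_sets)
    then show ?thesis
      unfolding ik(3) B_def by (simp add: vimage_def Int_def conj_commute)
  qed
  then have "{\<omega> \<in> space \<Omega>. Q {j \<in> ?J. B j \<omega>}} \<in> sets \<Omega>"
    by (intro sets_Collect_finite_pattern) auto
  moreover have "Q {j \<in> ?J. B j \<omega>} \<longleftrightarrow> captures M (\<lambda>i. {k \<in> {1..n}. X k \<omega> \<in> S i})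
      (index_blocks n (\<lambda>k. X k \<omega>) r)" for \<omega>
  proof -
    have "{(k, l). Inl (k, l) \<in> {j \<in> ?J. B j \<omega>}} = proximity n (\<lambda>k. X k \<omega>) r"
      by (auto simp: proximity_def B_def)
    then show ?thesis
      unfolding Q_def index_blocks_def by (auto simp: B_def intro!: captures_cong)
  qed
  ultimately show ?thesis
    by simp
qed

section \<open>Supports of measures\<close>

lemma closed_measure_support: "closed (measure_support \<mu>)"
proof -
  have "open (- measure_support \<mu>)"
    by (subst open_subopen) (fastforce simp: measure_support_def)
  then show ?thesis
    by (simp add: closed_def)
qed

text \<open>Each point outside the support has a null neighbourhood, which may be taken from a
  countable basis, so countably many null sets cover the complement.\<close>

lemma emeasure_Compl_measure_support:
  fixes \<mu> :: "'a::second_countable_topology measure"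
  assumes "sets \<mu> = sets borel"
  shows "emeasure \<mu> (- measure_support \<mu>) = 0"
proof -
  obtain \<B> :: "'a set set" where \<B>: "countable \<B>" "topological_basis \<B>"
    using ex_countable_basis by auto
  let ?\<N> = "{U \<in> \<B>. emeasure \<mu> U = 0}"
  have "- measure_support \<mu> \<subseteq> \<Union>?\<N>"
  proof
    fix x assume "x \<in> - measure_support \<mu>"
    then obtain U where U: "open U" "x \<in> U" "emeasure \<mu> U = 0"
      by (auto simp: measure_support_def zero_less_iff_neq_zero)
    then obtain V where V: "V \<in> \<B>" "x \<in> V" "V \<subseteq> U"
      using \<B>(2) topological_basisE by metis
    then have "emeasure \<mu> V = 0"
      using U emeasure_mono[of V U \<mu>] assms by auto
    then show "x \<in> \<Union>?\<N>"
      using V by auto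
  qed
  moreover have "(\<Union>U\<in>?\<N>. U) \<in> null_sets \<mu>"
  proof (rule null_sets_UN')
    show "countable ?\<N>"
      using \<B>(1) by (rule countable_subset[rotated]) auto
    show "U \<in> null_sets \<mu>" if "U \<in> ?\<N>" for U
      using that topological_basis_open[OF \<B>(2)] assms by (auto simp: null_sets_def intro: borel_open)
  qed
  ultimately show ?thesis
    using closed_measure_support[of \<mu>] assms emeasure_mono[of "- measure_support \<mu>" "\<Union>?\<N>" \<mu>]
    by (auto simp: null_sets_def)
qed

lemma measure_measure_support:
  fixes \<mu> :: "'a::second_countable_topology measure"
  assumes "prob_space \<mu>" "sets \<mu> = sets borel"
  shows "measure \<mu> (measure_support \<mu>) = 1"
proof -
  interpret prob_space \<mu> by fact
  have "measure_support \<mu> \<in> sets \<mu>"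
    using assms(2) borel_closed[OF closed_measure_support] by simp
  moreover have "space \<mu> - measure_support \<mu> = - measure_support \<mu>"
    using sets_eq_imp_space_eq[OF assms(2)] by auto
  ultimately show ?thesis
    using prob_compl[of "measure_support \<mu>"] emeasure_Compl_measure_support[OF assms(2)]
    by (simp add: measure_def)
qed

lemma measure_eq_0_outside_support:
  fixes \<mu> :: "'a::second_countable_topology measure"
  assumes "sets \<mu> = sets borel" "A \<inter> measure_support \<mu> = {}"
  shows "measure \<mu> A = 0"
proof -
  have "- measure_support \<mu> \<in> sets \<mu>"
    using assms(1) borel_open[OF open_Compl[OF closed_measure_support]] by simp
  then have "emeasure \<mu> A \<le> emeasure \<mu> (- measure_support \<mu>)"
    using assms(2) by (intro emeasure_mono) auto
  then show ?thesis
    using emeasure_Compl_measure_support[OF assms(1)] by (simp add: measure_def)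
qed

section \<open>From concentrated counts to the risk\<close>

lemma selected_radius_nonneg: "0 \<le> selected_radius M n x"
proof (cases "candidate_radii n x = {}")
  case False
  then show ?thesis
    using selected_radius_is_last_arg_max(1)[of n x M]
    by (auto simp: candidate_radii_def change_radii_def)
qed (simp add: selected_radius_def)

lemma clustering_risk_eq:
  fixes X :: "nat \<Rightarrow> 'w \<Rightarrow> 'a::real_normed_vector"
  assumes "\<And>\<omega>. 0 \<le> R \<omega>"
  shows "clustering_risk \<Omega> M n S X R =
    measure \<Omega> {\<omega> \<in> space \<Omega>. \<not> captures M (\<lambda>i. {k \<in> {1..n}. X k \<omega> \<in> S i})
      (index_blocks n (\<lambda>k. X k \<omega>) (R \<omega>))}"
  unfolding clustering_risk_def sample_captured_iff[OF assms, symmetric]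
  by (rule arg_cong[where f = "measure \<Omega>"]) blast

text \<open>The hypotheses \<open>eta0\<close> and \<open>eta1\<close> are the threshold conditions
  with denominators cleared; \<open>lo\<close> and \<open>hi\<close> bound the weights. They yield
  the size conditions of \<open>captures_selected_radius\<close> for
  \<open>b = lo (1 - \<eta>) (1 - \<epsilon>) n\<close>.\<close>

lemma captures_selected_radius_if_concentrated:
  fixes M n :: nat and x :: "nat \<Rightarrow> 'a::real_normed_vector" and S :: "nat \<Rightarrow> 'a set"
    and \<gamma> :: "nat \<Rightarrow> real" and \<epsilon> \<eta> lo hi r :: real
  defines "N \<equiv> \<lambda>i. {k \<in> {1..n}. x k \<in> S i}"
  assumes M: "2 \<le> M" and n: "0 < n" and eps: "\<epsilon> < 1" and \<eta>: "0 < \<eta>" "\<eta> < 1"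
    and sum: "(\<Sum>i\<in>{1..M}. \<gamma> i) = 1"
    and lo: "\<And>i. i \<in> {1..M} \<Longrightarrow> lo \<le> \<gamma> i" and hi: "\<And>i. i \<in> {1..M} \<Longrightarrow> \<gamma> i \<le> hi"
    and hi_lo: "0 < hi" "hi < 2 * lo"
    and eta0: "1 \<le> (1 - \<eta>) * (1 - \<epsilon>) * (1 + (lo - hi / 2))"
    and eta1: "4 * \<eta> * hi \<le> (lo - hi / 2) * (1 - \<eta>)"
    and disj: "\<And>i j. i \<in> {1..M} \<Longrightarrow> j \<in> {1..M} \<Longrightarrow> i \<noteq> j \<Longrightarrow> S i \<inter> S j = {}"
    and conc: "\<And>i. i \<in> {1..M} \<Longrightarrow>
      \<bar>card (N i) - n * ((1 - \<epsilon>) * \<gamma> i)\<bar> \<le> \<eta> * (n * ((1 - \<epsilon>) * \<gamma> i))"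
    and r: "0 \<le> r" and cap: "captures M N (index_blocks n x r)"
  shows "captures M N (index_blocks n x (selected_radius M n x))"
proof -
  \<comment> \<open>The expected number of observations in the groups altogether, as the weights sum
    to \<open>1\<close>.\<close>
  define m where "m = (1 - \<epsilon>) * real n"
  have m: "0 < m"
    using n eps by (simp add: m_def)
  have lower: "(1 - \<eta>) * m * \<gamma> i \<le> card (N i)" and upper: "card (N i) \<le> (1 + \<eta>) * m * \<gamma> i"
    if "i \<in> {1..M}" for i
    using conc[OF that] by (simp_all add: m_def abs_le_iff algebra_simps)
  let ?U = "\<Union>i\<in>{1..M}. N i"
  have "card ?U = (\<Sum>i\<in>{1..M}. card (N i))"
  proof (rule card_UN_disjoint)
    show "\<forall>i\<in>{1..M}. \<forall>j\<in>{1..M}. i \<noteq> j \<longrightarrow> N i \<inter> N j = {}"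
      using disj unfolding N_def by blast
  qed (auto simp: N_def)
  moreover have "(1 - \<eta>) * m \<le> (\<Sum>i\<in>{1..M}. real (card (N i)))"
  proof -
    have "(1 - \<eta>) * m = (\<Sum>i\<in>{1..M}. (1 - \<eta>) * m * \<gamma> i)"
      by (simp only: sum_distrib_left[symmetric] sum mult_1_right)
    also have "\<dots> \<le> (\<Sum>i\<in>{1..M}. real (card (N i)))"
      by (intro sum_mono lower)
    finally show ?thesis .
  qed
  moreover have "card ({1..n} - ?U) = n - card ?U" "card ?U \<le> card {1..n}"
    by (subst card_Diff_subset; force simp: N_def) (intro card_mono, auto simp: N_def)
  ultimately have "card ({1..n} - ?U) \<le> real n - (1 - \<eta>) * m"
    by simp
  also have "\<dots> \<le> (lo - hi / 2) * ((1 - \<eta>) * m)"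
  proof -
    \<comment> \<open>Multiplied by \<open>n\<close>, \<open>eta0\<close> says that \<open>n\<close>
      exceeds \<open>(1 - \<eta>) m\<close> by at most
      \<open>(lo - hi / 2) (1 - \<eta>) m\<close>.\<close>
    have "real n * 1 \<le> real n * ((1 - \<eta>) * (1 - \<epsilon>) * (1 + (lo - hi / 2)))"
      using eta0 by (intro mult_left_mono) auto
    also have "\<dots> = (1 - \<eta>) * m + (lo - hi / 2) * ((1 - \<eta>) * m)"
      unfolding m_def by algebra
    finally show ?thesis
      by simp
  qed
  finally have noise: "card ({1..n} - ?U) \<le> (lo - hi / 2) * ((1 - \<eta>) * m)" .
  let ?b = "lo * ((1 - \<eta>) * m)"
  have pos: "0 < (1 - \<eta>) * m"
    using m \<eta> by simp
  show ?thesis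
    unfolding N_def
  proof (rule captures_selected_radius[OF M r, where b = ?b])
    show "captures M (\<lambda>i. {k \<in> {1..n}. x k \<in> S i}) (index_blocks n x r)"
      using cap by (simp add: N_def)
    fix i assume i: "i \<in> {1..M}"
    have "?b \<le> \<gamma> i * ((1 - \<eta>) * m)"
      using lo[OF i] pos by (intro mult_right_mono) auto
    also have "\<dots> \<le> card (N i)"
      using lower[OF i] by (simp add: mult_ac)
    finally show "?b \<le> card {k \<in> {1..n}. x k \<in> S i}"
      by (simp add: N_def)
    have "(1 + \<eta>) * m * \<gamma> i \<le> (1 + \<eta>) * m * hi"
      using hi[OF i] m \<eta> by (intro mult_left_mono) auto
    then have "card (N i) + card ({1..n} - ?U) \<le> m * ((1 + \<eta>) * hi + (lo - hi / 2) * (1 - \<eta>))"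
      using upper[OF i] noise by (simp add: algebra_simps)
    \<comment> \<open>As \<open>2 lo = 2 (lo - hi / 2) + hi\<close>, the claim reduces to
      \<open>2 \<eta> hi < (lo - hi / 2) (1 - \<eta>)\<close>. The factor \<open>4\<close> in
      \<open>eta1\<close> leaves room for strictness.\<close>
    also have "(1 + \<eta>) * hi + (lo - hi / 2) * (1 - \<eta>) < 2 * (lo * (1 - \<eta>))"
    proof -
      have "0 < (lo - hi / 2) * (1 - \<eta>)"
        using hi_lo \<eta> by (intro mult_pos_pos) auto
      then have "2 * (\<eta> * hi) < (lo - hi / 2) * (1 - \<eta>)"
        using eta1 by simp
      moreover have "2 * (lo * (1 - \<eta>)) = 2 * ((lo - hi / 2) * (1 - \<eta>)) + hi * (1 - \<eta>)"
        by algebra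
      moreover have "(1 + \<eta>) * hi = hi * (1 - \<eta>) + 2 * (\<eta> * hi)"
        by algebra
      ultimately show ?thesis
        by linarith
    qed
    then have "m * ((1 + \<eta>) * hi + (lo - hi / 2) * (1 - \<eta>)) < m * (2 * (lo * (1 - \<eta>)))"
      using m by (rule mult_strict_left_mono)
    also have "\<dots> = 2 * ?b"
      by simp
    finally show "(card {k \<in> {1..n}. x k \<in> S i} +
        card ({1..n} - (\<Union>i\<in>{1..M}. {k \<in> {1..n}. x k \<in> S i}))) < 2 * ?b"
      by (simp add: N_def)
  next
    have "(lo - hi / 2) * ((1 - \<eta>) * m) < ?b"
      using hi_lo pos by (intro mult_strict_right_mono) auto
    then show "card ({1..n} - (\<Union>i\<in>{1..M}. {k \<in> {1..n}. x k \<in> S i})) < ?b"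
      using noise by (simp add: N_def)
  qed
qed

theorem theorem4p1:
  fixes M n :: nat
    and \<Omega> :: "'w measure"
    and X :: "nat \<Rightarrow> 'w \<Rightarrow> real ^ 'd"
    and P :: "nat \<Rightarrow> (real ^ 'd) measure"
    and S :: "nat \<Rightarrow> (real ^ 'd) set"
    and \<gamma> :: "nat \<Rightarrow> real"
    and \<epsilon> \<delta> \<gamma>_min \<gamma>_max \<gamma>_bar \<eta>0 \<eta>1 \<eta> :: real
  assumes M: "M \<ge> 2" and n: "n \<ge> M"
    and Omega: "prob_space \<Omega>"
    and P_prob: "\<And>i. i \<le> M \<Longrightarrow> prob_space (P i)"
    and P_sets: "\<And>i. i \<le> M \<Longrightarrow> sets (P i) = sets borel"
    and P_cube: "\<And>i. i \<le> M \<Longrightarrow> measure (P i) (cbox 0 1) = 1"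
    and eps: "0 \<le> \<epsilon>" "\<epsilon> < 1"
    and gamma_nonneg: "\<And>i. i \<in> {1..M} \<Longrightarrow> \<gamma> i \<ge> 0"
    and gamma_sum: "(\<Sum>i\<in>{1..M}. \<gamma> i) = 1"
    and X_cube: "\<And>k \<omega>. k \<in> {1..n} \<Longrightarrow> \<omega> \<in> space \<Omega> \<Longrightarrow> X k \<omega> \<in> cbox 0 1"
    and X_indep: "prob_space.indep_vars \<Omega> (\<lambda>_. borel) X {1..n}"
    and X_law: "\<And>k A. k \<in> {1..n} \<Longrightarrow> A \<in> sets borel \<Longrightarrow>
      measure (distr \<Omega> borel (X k)) A =
        \<epsilon> * measure (P 0) A + (1 - \<epsilon>) * (\<Sum>i\<in>{1..M}. \<gamma> i * measure (P i) A)"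
    and S_def: "\<And>i. i \<in> {1..M} \<Longrightarrow> S i = measure_support (P i)"
    and S0_def: "S 0 = cbox 0 1 - (\<Union>i\<in>{1..M}. S i)"
    and P0_support: "measure_support (P 0) \<subseteq> closure (S 0)"
    and P0_null: "\<And>i. i \<in> {1..M} \<Longrightarrow> measure (P 0) (closure (S 0) \<inter> S i) = 0"
    and S_connected: "\<And>i. i \<in> {1..M} \<Longrightarrow> connected (S i)"
    and delta_def: "\<delta> = Min {setdist (S i) (S j) | i j. 1 \<le> i \<and> i < j \<and> j \<le> M}"
    and delta_pos: "\<delta> > 0"
    and gamma_min_def: "\<gamma>_min = Min (\<gamma> ` {1..M})"
    and gamma_max_def: "\<gamma>_max = Max (\<gamma> ` {1..M})"
    and gamma_bar_def: "\<gamma>_bar = \<gamma>_min - \<gamma>_max / 2"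
    and gamma_ratio: "\<gamma>_max < 2 * \<gamma>_min"
    and eps_small: "\<epsilon> < \<gamma>_bar / (1 + \<gamma>_bar)"
    and eta0_pos: "\<eta>0 > 0"
    and eta0: "\<eta>0 = 1 - inverse ((1 - \<epsilon>) * (1 + \<gamma>_bar))"
    and eta1_pos: "\<eta>1 > 0"
    and eta1: "4 * \<eta>1 / (1 - \<eta>1) = \<gamma>_min / \<gamma>_max - 1 / 2"
    and eta: "0 < \<eta>" "\<eta> \<le> min \<eta>0 \<eta>1"
  shows "(\<forall>t>0. psi t > 0) \<and>
    clustering_risk \<Omega> M n S X (\<lambda>\<omega>. selected_radius M n (\<lambda>k. X k \<omega>))
      \<le> (INF r\<in>{0<..}. clustering_risk \<Omega> M n S X (\<lambda>_. r))
          + 2 * real M * exp (- psi \<eta> * (1 - \<epsilon>) * \<gamma>_bar * real n)"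
proof (intro conjI)
  show "\<forall>t>0. psi t > 0"
    using psi_pos by blast
  interpret prob_space \<Omega> by fact
  let ?N = "\<lambda>\<omega> i. {k \<in> {1..n}. X k \<omega> \<in> S i}"
  let ?Q = "\<lambda>\<omega>. index_blocks n (\<lambda>k. X k \<omega>)"
  let ?sel = "\<lambda>\<omega>. selected_radius M n (\<lambda>k. X k \<omega>)"

  \<comment> \<open>Distribution of the group counts\<close>
  have X_meas: "X k \<in> borel_measurable \<Omega>" if "k \<in> {1..n}" for k
    using X_indep that by (auto simp: indep_vars_def)
  have S_borel: "S i \<in> sets borel" if "i \<in> {1..M}" for i
    using S_def[OF that] borel_closed[OF closed_measure_support] by simp

  have S_disjoint_less: "S i \<inter> S j = {}" if ij: "1 \<le> i" "i < j" "j \<le> M" for i j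
  proof -
    let ?D = "{setdist (S i) (S j) | i j. 1 \<le> i \<and> i < j \<and> j \<le> M}"
    have "?D \<subseteq> (\<lambda>(i, j). setdist (S i) (S j)) ` ({1..M} \<times> {1..M})"
      by force
    then have "finite ?D"
      by (rule finite_subset) auto
    moreover have "setdist (S i) (S j) \<in> ?D"
      using ij by blast
    ultimately have "\<delta> \<le> setdist (S i) (S j)"
      unfolding delta_def by (rule Min_le)
    then have "0 < setdist (S i) (S j)"
      using delta_pos by simp
    moreover have "setdist (S i) (S j) \<le> dist z z" if "z \<in> S i" "z \<in> S j" for z
      using that by (rule setdist_le_dist)
    ultimately show ?thesis
      by fastforce
  qed
  have S_disjoint: "S i \<inter> S j = {}" if "i \<in> {1..M}" "j \<in> {1..M}" "i \<noteq> j" for i j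
    using S_disjoint_less[of i j] S_disjoint_less[of j i] that by (cases "i < j") auto

  have P_S: "measure (P j) (S i) = (if i = j then 1 else 0)" if "i \<in> {1..M}" "j \<in> {1..M}" for i j
  proof (cases "i = j")
    case True
    then show ?thesis
      using measure_measure_support[OF P_prob P_sets, of j] S_def[OF that(2)] that by simp
  next
    case False
    then show ?thesis
      using measure_eq_0_outside_support[OF P_sets, of j "S i"] S_disjoint[OF that]
        S_def[OF that(2)] that by simp
  qed
  \<comment> \<open>The part of \<open>S i\<close> outside \<open>closure (S 0)\<close> misses the
    support of \<open>P 0\<close>; the part inside is null by \<open>P0_null\<close>.\<close>
  have P0_S: "measure (P 0) (S i) = 0" if i: "i \<in> {1..M}" for i
  proof -
    interpret P0: prob_space "P 0"
      by (rule P_prob) simp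
    have sets: "S i \<in> sets (P 0)" "closure (S 0) \<in> sets (P 0)"
      using S_borel[OF i] P_sets[of 0] by auto
    have "measure (P 0) (S i - closure (S 0)) = 0"
      using P0_support by (intro measure_eq_0_outside_support P_sets) auto
    moreover have "measure (P 0) (S i) \<le>
        measure (P 0) (S i - closure (S 0)) + measure (P 0) (closure (S 0) \<inter> S i)"
    proof -
      have "S i = (S i - closure (S 0)) \<union> (closure (S 0) \<inter> S i)"
        by blast
      then show ?thesis
        using sets by (metis measure_Un_le sets.Diff sets.Int)
    qed
    ultimately show ?thesis
      using P0_null[OF i] measure_nonneg[of "P 0" "S i"] by simp
  qed
  have prob_S: "prob (X k -` S i \<inter> space \<Omega>) = (1 - \<epsilon>) * \<gamma> i"
    if k: "k \<in> {1..n}" and i: "i \<in> {1..M}" for k i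
  proof -
    have "prob (X k -` S i \<inter> space \<Omega>) = measure (distr \<Omega> borel (X k)) (S i)"
      using X_meas[OF k] S_borel[OF i] by (simp add: measure_distr)
    also have "\<dots> = (1 - \<epsilon>) * (\<Sum>j\<in>{1..M}. \<gamma> j * measure (P j) (S i))"
      using X_law[OF k S_borel[OF i]] P0_S[OF i] by simp
    also have "(\<Sum>j\<in>{1..M}. \<gamma> j * measure (P j) (S i)) = (\<Sum>j\<in>{1..M}. if i = j then \<gamma> j else 0)"
      using P_S[OF i] by (intro sum.cong) auto
    also have "\<dots> = \<gamma> i"
      using i by simp
    finally show ?thesis .
  qed

  \<comment> \<open>Weights and thresholds\<close>
  have gamma_min: "\<gamma>_min \<le> \<gamma> i" and gamma_max: "\<gamma> i \<le> \<gamma>_max" if "i \<in> {1..M}" for i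
    using that by (auto simp: gamma_min_def gamma_max_def)
  have "\<gamma>_min \<le> \<gamma>_max"
    using gamma_min[of 1] gamma_max[of 1] M by simp
  then have gamma_pos: "0 < \<gamma>_max" "0 < \<gamma>_min" "0 < \<gamma>_bar"
    using gamma_ratio by (simp_all add: gamma_bar_def)
  have n_pos: "0 < n"
    using M n by simp
  have "1 / 2 < \<gamma>_min / \<gamma>_max"
    using gamma_ratio gamma_pos by (simp add: field_simps)
  then have "0 < 4 * \<eta>1 / (1 - \<eta>1)"
    using eta1 by simp
  \<comment> \<open>With \<open>\<eta>1 > 0\<close>, a positive quotient forces a positive
    denominator.\<close>
  then have eta1_lt: "\<eta>1 < 1"
    using eta1_pos by (simp add: zero_less_divide_iff)
  then have eta_lt: "\<eta> < 1"
    using eta by simp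
  have eta1': "4 * \<eta> * \<gamma>_max \<le> (\<gamma>_min - \<gamma>_max / 2) * (1 - \<eta>)"
  proof -
    have "4 * \<eta> * \<gamma>_max \<le> 4 * \<eta>1 * \<gamma>_max"
      using eta gamma_pos by (intro mult_right_mono) auto
    also have "\<dots> = (\<gamma>_min - \<gamma>_max / 2) * (1 - \<eta>1)"
      using eta1 eta1_lt gamma_pos by (simp add: field_simps)
    also have "\<dots> \<le> (\<gamma>_min - \<gamma>_max / 2) * (1 - \<eta>)"
      using eta gamma_ratio by (intro mult_left_mono) auto
    finally show ?thesis .
  qed
  have eta0': "1 \<le> (1 - \<eta>) * (1 - \<epsilon>) * (1 + (\<gamma>_min - \<gamma>_max / 2))"
  proof -
    have pos: "0 < (1 - \<epsilon>) * (1 + \<gamma>_bar)"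
      using eps gamma_pos by simp
    have "inverse ((1 - \<epsilon>) * (1 + \<gamma>_bar)) \<le> 1 - \<eta>"
      using eta eta0 by simp
    then have "inverse ((1 - \<epsilon>) * (1 + \<gamma>_bar)) * ((1 - \<epsilon>) * (1 + \<gamma>_bar)) \<le>
        (1 - \<eta>) * ((1 - \<epsilon>) * (1 + \<gamma>_bar))"
      using pos by (intro mult_right_mono) auto
    moreover have "inverse ((1 - \<epsilon>) * (1 + \<gamma>_bar)) * ((1 - \<epsilon>) * (1 + \<gamma>_bar)) = 1"
      using pos by (intro left_inverse less_imp_neq[symmetric])
    ultimately show ?thesis
      by (simp add: gamma_bar_def mult.assoc)
  qed

  \<comment> \<open>Deviation events and comparison with a fixed radius\<close>
  define Bad where "Bad = (\<lambda>i. {\<omega> \<in> space \<Omega>.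
    \<eta> * (n * ((1 - \<epsilon>) * \<gamma> i)) < \<bar>card (?N \<omega> i) - n * ((1 - \<epsilon>) * \<gamma> i)\<bar>})"
  have Bad_event: "Bad i \<in> events" if "i \<in> {1..M}" for i
  proof -
    have [measurable]: "(\<lambda>\<omega>. real (card (?N \<omega> i))) \<in> borel_measurable \<Omega>"
      using X_meas S_borel[OF that] by (intro measurable_count) auto
    show ?thesis
      unfolding Bad_def by measurable
  qed
  have Bad_le: "prob (Bad i) \<le> 2 * exp (- psi \<eta> * (1 - \<epsilon>) * \<gamma>_bar * real n)" if i: "i \<in> {1..M}" for i
  proof -
    have "prob (Bad i) \<le> 2 * exp (- psi \<eta> * (card {1..n} * ((1 - \<epsilon>) * \<gamma> i)))"
      using chernoff_count_two_sided[OF _ X_indep S_borel[OF i] prob_S[OF _ i], of \<eta>]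
        eps gamma_nonneg[OF i] eta eta_lt by (simp add: Bad_def)
    \<comment> \<open>Replacing \<open>\<gamma> i\<close> by the smaller \<open>\<gamma>_bar\<close>
      gives all groups the same bound; summing over the \<open>M\<close> groups then produces the
      factor \<open>2 M\<close>.\<close>
    also have "\<dots> \<le> 2 * exp (- psi \<eta> * (1 - \<epsilon>) * \<gamma>_bar * real n)"
    proof -
      have "\<gamma>_bar \<le> \<gamma> i"
        using gamma_min[OF i] gamma_pos by (simp add: gamma_bar_def)
      then have "psi \<eta> * (1 - \<epsilon>) * real n * \<gamma>_bar \<le> psi \<eta> * (1 - \<epsilon>) * real n * \<gamma> i"
        using psi_pos[OF eta(1)] eps by (intro mult_left_mono) auto
      then show ?thesis
        by (simp add: mult_ac)
    qed
    finally show ?thesis .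
  qed

  \<comment> \<open>The error term is kept on the left, which makes the left side a lower bound for
    the risks at all \<open>r > 0\<close> and hence for their infimum.\<close>
  have "clustering_risk \<Omega> M n S X ?sel - 2 * real M * exp (- psi \<eta> * (1 - \<epsilon>) * \<gamma>_bar * real n)
      \<le> clustering_risk \<Omega> M n S X (\<lambda>_. r)" if r: "0 < r" for r
  proof -
    let ?F = "\<lambda>R. {\<omega> \<in> space \<Omega>. \<not> captures M (?N \<omega>) (?Q \<omega> (R \<omega>))}"
    have F_r: "?F (\<lambda>_. r) \<in> events"
      by (intro sets.sets_Collect_neg sets_Collect_captures X_meas S_borel)
    have Bad_events: "(\<Union>i\<in>{1..M}. Bad i) \<in> events"
      using Bad_event by (intro sets.finite_UN) auto
    have "?F ?sel \<subseteq> ?F (\<lambda>_. r) \<union> (\<Union>i\<in>{1..M}. Bad i)"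
    proof (rule subsetI, rule ccontr)
      fix \<omega> assume \<omega>: "\<omega> \<in> ?F ?sel" "\<omega> \<notin> ?F (\<lambda>_. r) \<union> (\<Union>i\<in>{1..M}. Bad i)"
      then have "captures M (?N \<omega>) (?Q \<omega> r)"
        by blast
      moreover have "\<bar>card (?N \<omega> i) - n * ((1 - \<epsilon>) * \<gamma> i)\<bar> \<le> \<eta> * (n * ((1 - \<epsilon>) * \<gamma> i))"
        if "i \<in> {1..M}" for i
        using \<omega> that unfolding Bad_def by fastforce
      ultimately have "captures M (?N \<omega>) (?Q \<omega> (?sel \<omega>))"
        using r by (intro captures_selected_radius_if_concentrated[OF M n_pos eps(2) eta(1) eta_lt
              gamma_sum gamma_min gamma_max gamma_pos(1) gamma_ratio eta0' eta1' S_disjoint]) auto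
      then show False
        using \<omega>(1) by blast
    qed
    \<comment> \<open>Monotonicity asks for measurability of the larger set, which involves the
      fixed radius \<open>r\<close> and the counts but not the selected radius.\<close>
    then have "prob (?F ?sel) \<le> prob (?F (\<lambda>_. r) \<union> (\<Union>i\<in>{1..M}. Bad i))"
      using F_r Bad_events by (intro finite_measure_mono) auto
    also have "\<dots> \<le> prob (?F (\<lambda>_. r)) + prob (\<Union>i\<in>{1..M}. Bad i)"
      using F_r Bad_events by (rule measure_Un_le)
    also have "prob (\<Union>i\<in>{1..M}. Bad i) \<le> (\<Sum>i\<in>{1..M}. prob (Bad i))"
      using Bad_event by (intro measure_UNION_le) auto
    also have "\<dots> \<le> (\<Sum>i\<in>{1..M}. 2 * exp (- psi \<eta> * (1 - \<epsilon>) * \<gamma>_bar * real n))"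
      by (intro sum_mono Bad_le)
    finally show ?thesis
      using r by (simp add: clustering_risk_eq selected_radius_nonneg)
  qed
  then have "clustering_risk \<Omega> M n S X ?sel - 2 * real M * exp (- psi \<eta> * (1 - \<epsilon>) * \<gamma>_bar * real n)
      \<le> (INF r\<in>{0<..}. clustering_risk \<Omega> M n S X (\<lambda>_. r))"
    by (intro cINF_greatest) auto
  then show "clustering_risk \<Omega> M n S X ?sel
      \<le> (INF r\<in>{0<..}. clustering_risk \<Omega> M n S X (\<lambda>_. r))
          + 2 * real M * exp (- psi \<eta> * (1 - \<epsilon>) * \<gamma>_bar * real n)"
    by simp
qed

end
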